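(* Let $m\ge 2$ and $n\ge 1$ be integers. The critical group of the Kautz graph $\mathrm{Kautz}_n(m)$ is \[K(\mathrm{Kautz}_n(m))\cong(\mathbb{Z}_{m+1})^{m-1}\oplus(\mathbb{Z}_{m^{n-1}})^{m^2-2}\oplus\bigoplus_{i=1}^{n-2}(\mathbb{Z}_{m^i})^{m^{n-2-i}(m-1)^2(m+1)}.\]
   Context: A Kautz string is a string in which no two adjacent characters are equal. The Kautz graph $\mathrm{Kautz}_n(m)$ is the directed graph whose vertices are the Kautz strings of length $n$ over an alphabet of $m+1$ symbols and whose edges are the Kautz strings $s_0s_1\ldots s_n$ of length $n+1$, the edge $s_0\ldots s_n$ going from $s_0\ldots s_{n-1}$ to $s_1\ldots s_n$. Thus $\mathrm{Kautz}_1(m)$ is the complete directed graph on $m+1$ vertices without loops, and $\mathrm{Kautz}_{n+1}(m)$ is the directed line graph of $\mathrm{Kautz}_n(m)$. For a finite strongly connected directed graph $G=(V,E)$ with $\mathrm{indeg}(v)=\mathrm{outdeg}(v)$ for all $v$ (Eulerian), let $\mathbb{Z}^V$ be the free abelian group on $V$, set $\Delta_v=\sum_{e\in E:\ s(e)=v}(t(e)-v)$, and for $r\in V$ define $K(G,r)=\mathbb{Z}^V/\langle r,\ \Delta_v : v\in V\setminus\{r\}\rangle$; for Eulerian $G$ these groups are isomorphic for all $r$, and the common group is the critical group $K(G)$. $\mathbb{Z}_k$ denotes the cyclic group of order $k$ ($\mathbb{Z}_1$ is trivial). *)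

theory Defs
  imports "HOL-Algebra.Algebra" "Graph_Theory.Digraph"
begin

text \<open>
  The parameter \<open>m\<close> is the out-degree in the Kautz graph; the alphabet \<open>{0..m}\<close> has
  \<open>m + 1\<close> symbols.
\<close>

definition kautz_strings :: "nat \<Rightarrow> nat \<Rightarrow> nat list set" where
  "kautz_strings m k = {s. length s = k \<and> set s \<subseteq> {0..m} \<and> distinct_adj s}"

definition kautz_graph :: "nat \<Rightarrow> nat \<Rightarrow> (nat list, nat list) pre_digraph" where
  "kautz_graph n m =
     \<lparr>verts = kautz_strings m n, arcs = kautz_strings m (n + 1), tail = butlast, head = tl\<rparr>"

definition laplacian_at :: "('v, 'e) pre_digraph \<Rightarrow> 'v \<Rightarrow> 'v \<Rightarrow>\<^sub>0 int" where
  "laplacian_at G v = (\<Sum>e \<in> out_arcs G v. frag_of (head G e) - frag_of v)"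

text \<open>
  \<open>critical_group G r\<close> is the group $K(G,r)$ with root \<open>r\<close>. For a finite strongly connected
  Eulerian graph its isomorphism type does not depend on \<open>r\<close>, so a statement about the critical
  group $K(G)$ up to isomorphism is a statement about \<open>critical_group G r\<close> for every vertex \<open>r\<close>.
\<close>

definition critical_group :: "('v, 'e) pre_digraph \<Rightarrow> 'v \<Rightarrow> ('v \<Rightarrow>\<^sub>0 int) set monoid" where
  "critical_group G r =
     free_Abelian_group (verts G) Mod
       generate (free_Abelian_group (verts G))
         (insert (frag_of r) (laplacian_at G ` (verts G - {r})))"

definition cyclic_power :: "nat \<Rightarrow> nat \<Rightarrow> (nat \<Rightarrow> int) monoid" where
  "cyclic_power k a = sum_group {..<a} (\<lambda>_. integer_mod_group k)"

end

theory Submission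
  imports Defs
begin

text \<open>
  Write \<open>K\<^sub>n\<close> for the critical group. Summing right extensions gives a map
  \<open>phi : K\<^sub>n \<rightarrow> K\<^sub>n\<^sub>+\<^sub>1\<close> with image \<open>m K\<^sub>n\<^sub>+\<^sub>1\<close>, since \<open>m [v]\<close> equals \<open>phi [tl v]\<close>.
  It is injective, and \<open>K\<^sub>n\<^sub>+\<^sub>1 / m K\<^sub>n\<^sub>+\<^sub>1\<close> is free over the integers modulo \<open>m\<close> of rank
  \<open>|V\<^sub>n\<^sub>+\<^sub>1| - |V\<^sub>n| - 1\<close>, which bounds the order of \<open>K\<^sub>n\<close> from below by induction.
  Conversely, generators of \<open>K\<^sub>n\<close> yield generators of \<open>K\<^sub>n\<^sub>+\<^sub>1\<close>: those of order prime to \<open>m\<close> are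
  mapped by \<open>phi\<close>, those of order \<open>m\<^sup>i\<close> are divided by \<open>m\<close> by prepending a letter, and the differences
  of two strings that agree except in the first letter supply the new elements of order \<open>m\<close>. Hence the
  product of cyclic groups maps onto \<open>K\<^sub>n\<close>, and by the order bound this map is an isomorphism.
\<close>

subsection \<open>Maps from products of cyclic groups\<close>

text \<open>Only \<open>A\<close> has to lie in the image, so covers of several small sets can be
  joined by taking products of their domains; surjectivity comes at the end, once \<open>A\<close>
  generates \<open>K\<close>.\<close>

definition covers :: "('a, 'c) monoid_scheme \<Rightarrow> ('b, 'd) monoid_scheme \<Rightarrow> 'b set \<Rightarrow> bool" where
  "covers T K A \<longleftrightarrow> (\<exists>h \<in> hom T K. A \<subseteq> h ` carrier T)"

context comm_group
begin

lemma covers_integer_mod_group: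
  assumes x: "x \<in> carrier G" and d: "x [^] d = \<one>" "d > 0"
  shows "covers (integer_mod_group d) G {x}"
proof -
  \<comment> \<open>Addition in \<open>integer_mod_group d\<close> reduces modulo \<open>d\<close>;
    powers of \<open>x\<close> survive this reduction because \<open>d\<close> annihilates
    \<open>x\<close>.\<close>
  have red: "x [^] (k mod int d) = x [^] k" for k :: int
  proof -
    have "x [^] k = x [^] (int d * (k div int d) + k mod int d)" by simp
    also have "\<dots> = (x [^] int d) [^] (k div int d) \<otimes> x [^] (k mod int d)"
      using x by (simp only: int_pow_mult int_pow_pow)
    also have "x [^] int d = \<one>" using d by (simp add: int_pow_int)
    finally show ?thesis using x by simp
  qed
  have "(\<lambda>k::int. x [^] k) \<in> hom (integer_mod_group d) G"
    using x by (auto simp: hom_def red int_pow_mult)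
  moreover have "x = x [^] (1 mod int d)" using x by (simp only: red int_pow_1)
  moreover have "1 mod int d \<in> carrier (integer_mod_group d)"
    using d by (simp add: carrier_integer_mod_group)
  ultimately show ?thesis unfolding covers_def by blast
qed

text \<open>As \<open>G\<close> is commutative, the pointwise product of two homomorphisms into it
  is a homomorphism; it restricts to the given one on each factor.\<close>

lemma covers_DirProd:
  assumes "covers S G A" "covers T G Y" and "group S" "group T"
  shows "covers (S \<times>\<times> T) G (A \<union> Y)"
proof -
  obtain f g where f: "f \<in> hom S G" "A \<subseteq> f ` carrier S" and g: "g \<in> hom T G" "Y \<subseteq> g ` carrier T"
    using assms unfolding covers_def by blast
  interpret S: group S by fact
  interpret T: group T by fact
  interpret f: group_hom S G f using f by unfold_locales
  interpret g: group_hom T G g using g by unfold_locales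
  let ?h = "\<lambda>(x, y). f x \<otimes> g y"
  have "?h \<in> hom (S \<times>\<times> T) G"
    by (auto simp: hom_def m_ac)
  moreover have "A \<subseteq> ?h ` carrier (S \<times>\<times> T)"
  proof
    fix x assume "x \<in> A"
    then obtain s where "s \<in> carrier S" "x = f s" using f by blast
    then have "x = ?h (s, \<one>\<^bsub>T\<^esub>)" "(s, \<one>\<^bsub>T\<^esub>) \<in> carrier (S \<times>\<times> T)" by auto
    then show "x \<in> ?h ` carrier (S \<times>\<times> T)" by blast
  qed
  moreover have "Y \<subseteq> ?h ` carrier (S \<times>\<times> T)"
  proof
    fix y assume "y \<in> Y"
    then obtain t where "t \<in> carrier T" "y = g t" using g by blast
    then have "y = ?h (\<one>\<^bsub>S\<^esub>, t)" "(\<one>\<^bsub>S\<^esub>, t) \<in> carrier (S \<times>\<times> T)" by auto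
    then show "y \<in> ?h ` carrier (S \<times>\<times> T)" by blast
  qed
  ultimately show ?thesis unfolding covers_def by blast
qed

lemma covers_sum_group:
  assumes I: "finite I" and cov: "\<And>i. i \<in> I \<Longrightarrow> covers (T i) G (A i)"
    and grp: "\<And>i. i \<in> I \<Longrightarrow> group (T i)"
  shows "covers (sum_group I T) G (\<Union>i\<in>I. A i)"
proof -
  have "\<forall>i\<in>I. \<exists>f. f \<in> hom (T i) G \<and> A i \<subseteq> f ` carrier (T i)"
    using cov unfolding covers_def by blast
  then obtain f where f: "\<And>i. i \<in> I \<Longrightarrow> f i \<in> hom (T i) G" "\<And>i. i \<in> I \<Longrightarrow> A i \<subseteq> f i ` carrier (T i)"
    by metis
  let ?h = "\<lambda>x. gfinprod G (\<lambda>i. f i (x i)) I"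
  have "?h \<in> hom (sum_group I T) G"
    using f(1) grp by (rule hom_group_sum)
  moreover have "A i \<subseteq> ?h ` carrier (sum_group I T)" if i: "i \<in> I" for i
  proof
    fix y assume "y \<in> A i"
    then obtain t where t: "t \<in> carrier (T i)" "y = f i t" using f(2)[OF i] by blast
    define s where "s = (\<lambda>j\<in>I. if j = i then t else \<one>\<^bsub>T j\<^esub>)"
    have one: "\<one>\<^bsub>T j\<^esub> \<in> carrier (T j)" if "j \<in> I" for j
      using grp[OF that] by (simp add: Group.group_def)
    have s: "s \<in> carrier (sum_group I T)"
      using I t one grp by (auto simp: carrier_sum_group s_def)
    have fc: "f i t \<in> carrier G" using f(1)[OF i] t(1) by (simp add: hom_in_carrier)
    have "f j (s j) = (if i = j then f i t else \<one>)" if "j \<in> I" for j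
      using that hom_one[OF f(1)[OF that] grp[OF that] is_group] by (auto simp: s_def)
    then have "?h s = finprod G (\<lambda>j. if i = j then f i t else \<one>) I"
      using I fc by (subst gfinprod_eq_finprod) (auto intro!: finprod_cong simp: Pi_def)
    also have "\<dots> = y"
      using finprod_singleton[OF i I, of "\<lambda>_. f i t"] fc t by simp
    finally show "y \<in> ?h ` carrier (sum_group I T)" using s by blast
  qed
  ultimately show ?thesis unfolding covers_def by blast
qed

lemma covers_mono: "covers T G Y \<Longrightarrow> A \<subseteq> Y \<Longrightarrow> covers T G A"
  unfolding covers_def by blast

lemma covers_cyclic_power:
  assumes A: "A \<subseteq> carrier G" "finite A" "card A \<le> a"
    and d: "d > 0" "\<And>x. x \<in> A \<Longrightarrow> x [^] d = \<one>"
  shows "covers (cyclic_power d a) G A"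
proof -
  obtain e where e: "bij_betw e {..<card A} A"
    using ex_bij_betw_nat_finite[OF A(2)] by (auto simp: atLeast0LessThan)
  \<comment> \<open>\<open>A\<close> may have fewer than \<open>a\<close> elements; the surplus
    factors are sent to the identity.\<close>
  define f where "f i = (if i < card A then e i else \<one>)" for i
  have ex: "e i \<in> A" if "i < card A" for i
    using bij_betwE[OF e] that by auto
  have "covers (integer_mod_group d) G {f i}" for i
    using ex A d by (intro covers_integer_mod_group) (auto simp: f_def)
  then have "covers (cyclic_power d a) G (\<Union>i\<in>{..<a}. {f i})"
    unfolding cyclic_power_def by (intro covers_sum_group) auto
  moreover have "A \<subseteq> f ` {..<a}"
  proof
    fix x assume "x \<in> A"
    then obtain i where "i < card A" "x = e i"
      using e by (metis bij_betw_imp_surj_on image_iff lessThan_iff)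
    then show "x \<in> f ` {..<a}" using A(3) by (auto simp: f_def)
  qed
  ultimately show ?thesis unfolding UNION_singleton_eq_range by (rule covers_mono)
qed

end

lemma group_cyclic_power [simp]: "group (cyclic_power d a)"
  by (simp add: cyclic_power_def)

lemma carrier_sum_group_finite:
  assumes "finite I" "\<And>i. i \<in> I \<Longrightarrow> group (G i)"
  shows "carrier (sum_group I G) = (\<Pi>\<^sub>E i\<in>I. carrier (G i))"
  using assms by (auto simp: carrier_sum_group)

lemma finite_card_cyclic_power:
  assumes "d > 0"
  shows "finite (carrier (cyclic_power d a))" "card (carrier (cyclic_power d a)) = d ^ a"
proof -
  have "carrier (cyclic_power d a) = ({..<a} \<rightarrow>\<^sub>E {0..<int d})"
    using assms by (simp add: cyclic_power_def carrier_sum_group_finite carrier_integer_mod_group)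
  then show "finite (carrier (cyclic_power d a))" "card (carrier (cyclic_power d a)) = d ^ a"
    by (simp_all add: finite_PiE card_PiE)
qed

text \<open>The image of \<open>h\<close> is a subgroup containing the generators, hence all of
  \<open>K\<close>. So \<open>K\<close> is finite, which releases the cardinality bound, and a
  surjection from a finite set onto one at least as large is injective.\<close>

lemma iso_of_covers:
  assumes T: "group T" "finite (carrier T)" and K: "group K"
    and h: "covers T K A" and gen: "\<And>S. subgroup S K \<Longrightarrow> A \<subseteq> S \<Longrightarrow> S = carrier K"
    and card: "finite (carrier K) \<Longrightarrow> card (carrier T) \<le> card (carrier K)"
  shows "K \<cong> T"
proof -
  obtain h where h: "h \<in> hom T K" "A \<subseteq> h ` carrier T" using h unfolding covers_def by blast
  interpret group_hom T K h using T K h by (simp add: group_hom_def group_hom_axioms_def)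
  have surj: "h ` carrier T = carrier K" using gen[OF img_is_subgroup h(2)] .
  then have "finite (carrier K)" using T(2) by (metis finite_imageI)
  then have "card (carrier T) \<le> card (h ` carrier T)" using card surj by simp
  then have "inj_on h (carrier T)"
    using T(2) card_image_le[OF T(2), of h] by (intro eq_card_imp_inj_on) auto
  then have "T \<cong> K" using h(1) surj by (intro is_isoI isoI) (auto simp: bij_betw_def)
  then show ?thesis by (rule group.iso_sym[OF T(1)])
qed

subsection \<open>Finitely supported integer functions\<close>

text \<open>Subgroups without reference to a carrier, so that the lattice computations can use type
  class arithmetic in place of the operations of \<open>free_Abelian_group\<close>.\<close>

definition add_closed :: "'a::ab_group_add set \<Rightarrow> bool" where
  "add_closed S \<longleftrightarrow> 0 \<in> S \<and> (\<forall>x\<in>S. \<forall>y\<in>S. x - y \<in> S)"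

lemma add_closed_zero: "add_closed S \<Longrightarrow> 0 \<in> S"
  and add_closed_diff: "add_closed S \<Longrightarrow> x \<in> S \<Longrightarrow> y \<in> S \<Longrightarrow> x - y \<in> S"
  by (auto simp: add_closed_def)

lemma add_closed_minus: "add_closed S \<Longrightarrow> x \<in> S \<Longrightarrow> - x \<in> S"
  by (metis add_closed_def diff_0)

lemma add_closed_add: "add_closed S \<Longrightarrow> x \<in> S \<Longrightarrow> y \<in> S \<Longrightarrow> x + y \<in> S"
  by (metis add_closed_diff add_closed_minus diff_minus_eq_add)

lemma add_closed_sum: "add_closed S \<Longrightarrow> (\<And>i. i \<in> I \<Longrightarrow> f i \<in> S) \<Longrightarrow> sum f I \<in> S"
  by (induction I rule: infinite_finite_induct) (auto simp: add_closed_zero add_closed_add)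

lemma add_closed_cmul: "add_closed S \<Longrightarrow> x \<in> S \<Longrightarrow> frag_cmul k x \<in> S"
  by (rule frag_closure_minus_cmul) (auto simp: add_closed_zero add_closed_diff)

lemma add_closed_cong: "add_closed S \<Longrightarrow> x - y \<in> S \<Longrightarrow> x \<in> S \<longleftrightarrow> y \<in> S"
  by (metis add_closed_add add_closed_diff diff_add_cancel diff_diff_eq2 add_diff_cancel_left')

lemmas add_closed_rules = add_closed_zero add_closed_diff add_closed_minus add_closed_add
  add_closed_sum add_closed_cmul

lemma frag_cmul_cancel: "k \<noteq> 0 \<Longrightarrow> frag_cmul k x = frag_cmul k y \<longleftrightarrow> x = y"
  using frag_cmul_eq_0_iff[of k "x - y"] frag_cmul_distrib2[of k y "x - y"] by auto

lemma frag_cmul_diff_distrib2: "frag_cmul k (x - y) = frag_cmul k x - frag_cmul k y"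
  using frag_cmul_distrib2[of k "x - y" y] by simp

lemma frag_dvd:
  assumes "\<And>i. k dvd Poly_Mapping.lookup x i"
  obtains y where "x = frag_cmul k y" "Poly_Mapping.keys y \<subseteq> Poly_Mapping.keys x"
proof
  let ?y = "Poly_Mapping.map (\<lambda>c. c div k) x"
  have lk: "Poly_Mapping.lookup ?y i = Poly_Mapping.lookup x i div k" for i
    by (simp add: map.rep_eq when_def)
  then show "x = frag_cmul k ?y"
    using assms by (intro poly_mapping_eqI) simp
  show "Poly_Mapping.keys ?y \<subseteq> Poly_Mapping.keys x"
    by (auto simp: in_keys_iff lk)
qed

lemma frag_extend_closed:
  assumes "Poly_Mapping.keys x \<subseteq> I" "add_closed S" "\<And>i. i \<in> I \<Longrightarrow> f i \<in> S"
  shows "frag_extend f x \<in> S"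
  using assms(1) by (induction x rule: frag_induction)
    (use assms in \<open>auto simp: frag_extend_diff add_closed_rules\<close>)

definition frags :: "'a set \<Rightarrow> ('a \<Rightarrow>\<^sub>0 int) set" where
  "frags I = {x. Poly_Mapping.keys x \<subseteq> I}"

lemma add_closed_frags: "add_closed (frags I)"
  using keys_diff by (fastforce simp: add_closed_def frags_def)

lemma frag_of_frags [simp]: "frag_of i \<in> frags I \<longleftrightarrow> i \<in> I"
  by (simp add: frags_def)

lemma frags_subset: "add_closed S \<Longrightarrow> (\<And>i. i \<in> I \<Longrightarrow> frag_of i \<in> S) \<Longrightarrow> frags I \<subseteq> S"
  using frag_extend_closed[of _ I S frag_of] by (auto simp: frags_def simp flip: frag_expansion)

lemma frag_extend_eq_on_frags:
  "x \<in> frags I \<Longrightarrow> (\<And>i. i \<in> I \<Longrightarrow> f i = g i) \<Longrightarrow> frag_extend f x = frag_extend g x"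
  by (rule frag_extend_eq) (auto simp: frags_def)

lemma frag_extend_frag_extend:
  "frag_extend f (frag_extend g x) = frag_extend (\<lambda>i. frag_extend f (g i)) x"
  using subset_UNIV[of "Poly_Mapping.keys x"]
proof (induction x rule: frag_induction)
  case (diff a b)
  then show ?case by (simp add: frag_extend_diff)
qed auto

lemmas frag_extend_linear = frag_extend_add frag_extend_diff frag_extend_cmul frag_extend_minus

lemma frag_extend_finite_sum: "frag_extend f (sum g I) = (\<Sum>i\<in>I. frag_extend f (g i))"
  by (induction I rule: infinite_finite_induct) (auto simp: frag_extend_add)

lemma sum_const_frag: "finite I \<Longrightarrow> (\<Sum>i\<in>I. x) = frag_cmul (int (card I)) x"
  by (induction I rule: finite_induct) (auto simp: frag_cmul_distrib)

lemma carrier_free_Abelian_group: "carrier (free_Abelian_group I) = frags I"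
  by (auto simp: frags_def)

lemma subgroup_free_Abelian_group_iff:
  "subgroup S (free_Abelian_group I) \<longleftrightarrow> add_closed S \<and> S \<subseteq> frags I"
proof
  assume S: "subgroup S (free_Abelian_group I)"
  then have sub: "S \<subseteq> frags I" using subgroup.subset[OF S] by (simp add: carrier_free_Abelian_group)
  have "x - y \<in> S" if "x \<in> S" "y \<in> S" for x y
    using subgroup.m_closed[OF S that(1) subgroup.m_inv_closed[OF S that(2)]] sub that(2)
    by (auto simp: frags_def)
  then show "add_closed S \<and> S \<subseteq> frags I"
    using sub subgroup.one_closed[OF S] by (auto simp: add_closed_def)
next
  assume S: "add_closed S \<and> S \<subseteq> frags I"
  then have keys: "Poly_Mapping.keys x \<subseteq> I" if "x \<in> S" for x using that by (auto simp: frags_def)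
  show "subgroup S (free_Abelian_group I)"
  proof
    show "S \<subseteq> carrier (free_Abelian_group I)" using keys by (simp add: subset_iff)
  next
    fix x y assume "x \<in> S" "y \<in> S"
    then show "x \<otimes>\<^bsub>free_Abelian_group I\<^esub> y \<in> S" using S by (simp add: add_closed_add)
  next
    fix x assume x: "x \<in> S"
    then show "inv\<^bsub>free_Abelian_group I\<^esub> x \<in> S"
      using S keys[OF x] by (simp add: add_closed_minus)
  qed (use S in \<open>simp add: add_closed_zero\<close>)
qed

lemma r_coset_free_Abelian_group_eq_iff:
  assumes "add_closed H"
  shows "H #>\<^bsub>free_Abelian_group I\<^esub> x = H #>\<^bsub>free_Abelian_group I\<^esub> y \<longleftrightarrow> x - y \<in> H"
proof -
  have coset: "H #>\<^bsub>free_Abelian_group I\<^esub> z = {u. u - z \<in> H}" for z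
    by (auto simp: r_coset_def intro!: bexI[of _ "_ - z"])
  have "u - x \<in> H \<longleftrightarrow> u - y \<in> H" if "x - y \<in> H" for u
    using add_closed_cong[OF assms, of "u - y" "u - x"] that by simp
  moreover have "x - x \<in> H" using assms by (simp add: add_closed_zero)
  ultimately show ?thesis unfolding coset by blast
qed

section \<open>Integer combinations and systems of coset representatives\<close>

definition comb :: "'a set \<Rightarrow> ('a \<Rightarrow> int) \<Rightarrow> 'a \<Rightarrow>\<^sub>0 int" where
  "comb I s = (\<Sum>i\<in>I. frag_cmul (s i) (frag_of i))"

lemma lookup_comb: "finite I \<Longrightarrow> Poly_Mapping.lookup (comb I s) i = (if i \<in> I then s i else 0)"
  by (simp add: comb_def lookup_sum if_distrib cong: if_cong)

lemma comb_frags: "I \<subseteq> J \<Longrightarrow> comb I s \<in> frags J"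
  unfolding comb_def by (intro add_closed_rules add_closed_frags) auto

lemma mod_eq_on_interval:
  fixes a b :: int
  assumes "a \<in> {0..<d}" "b \<in> {0..<d}" "d dvd a - b"
  shows "a = b"
  using assms by (metis atLeastLessThan_iff mod_eq_dvd_iff mod_pos_pos_trivial)

text \<open>The elements of \<open>R\<close> represent distinct cosets of \<open>H\<close>. The size
  of \<open>R\<close> bounds the index of \<open>H\<close> from below before that index is known to
  be finite.\<close>

definition separated :: "'a::ab_group_add set \<Rightarrow> 'a set \<Rightarrow> bool" where
  "separated H R \<longleftrightarrow> (\<forall>x\<in>R. \<forall>y\<in>R. x - y \<in> H \<longrightarrow> x = y)"

lemma separated_image:
  assumes "0 \<in> H" "\<And>p q. p \<in> P \<Longrightarrow> q \<in> P \<Longrightarrow> f p - f q \<in> H \<Longrightarrow> p = q"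
  shows "separated H (f ` P)" "card (f ` P) = card P"
proof -
  have "inj_on f P" by (rule inj_onI) (use assms in auto)
  then show "card (f ` P) = card P" by (rule card_image)
  show "separated H (f ` P)" unfolding separated_def using assms(2) by blast
qed

subsection \<open>Kautz strings and the relation lattice\<close>

locale kautz =
  fixes m :: nat
  assumes m_ge: "m \<ge> 2"
begin

abbreviation V :: "nat \<Rightarrow> nat list set" where "V \<equiv> kautz_strings m"

lemma V_snoc: "w @ [c] \<in> V (Suc n) \<longleftrightarrow> w \<in> V n \<and> c \<le> m \<and> (w \<noteq> [] \<longrightarrow> c \<noteq> last w)"
  by (auto simp: kautz_strings_def distinct_adj_append_iff)

lemma V_Cons: "a # w \<in> V (Suc n) \<longleftrightarrow> w \<in> V n \<and> a \<le> m \<and> (w \<noteq> [] \<longrightarrow> a \<noteq> hd w)"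
  by (auto simp: kautz_strings_def distinct_adj_Cons)

lemma V_nonempty: "w \<in> V n \<Longrightarrow> n \<ge> 1 \<Longrightarrow> w \<noteq> []"
  by (auto simp: kautz_strings_def)

lemma V_tl: "w \<in> V (Suc n) \<Longrightarrow> tl w \<in> V n"
  by (cases w) (auto simp: V_Cons, auto simp: kautz_strings_def)

lemma V_butlast: "w \<in> V (Suc n) \<Longrightarrow> butlast w \<in> V n"
  by (cases w rule: rev_cases) (auto simp: V_snoc, auto simp: kautz_strings_def)

lemma V_last_le: "w \<in> V n \<Longrightarrow> n \<ge> 1 \<Longrightarrow> last w \<le> m"
  using V_nonempty[of w n] last_in_set[of w] by (force simp: kautz_strings_def)

lemma V_hd_le: "w \<in> V n \<Longrightarrow> n \<ge> 1 \<Longrightarrow> hd w \<le> m"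
  using V_nonempty[of w n] hd_in_set[of w] by (force simp: kautz_strings_def)

lemma finite_V [simp]: "finite (V n)"
  by (rule finite_subset[OF _ finite_lists_length_eq[of "{0..m}" n]])
    (auto simp: kautz_strings_def)

lemma V_1: "V (Suc 0) = (\<lambda>a. [a]) ` {0..m}"
  by (auto simp: kautz_strings_def length_Suc_conv)

lemma sum_snoc:
  assumes "n \<ge> 1"
  shows "(\<Sum>u\<in>V (Suc n). f u) = (\<Sum>v\<in>V n. \<Sum>c\<in>{0..m} - {last v}. f (v @ [c]))"
proof -
  have "(\<Sum>u\<in>V (Suc n). f u) = (\<Sum>(v, c)\<in>(SIGMA v:V n. {0..m} - {last v}). f (v @ [c]))"
    using V_nonempty assms
    by (intro sum.reindex_bij_witness[of _ "\<lambda>(v, c). v @ [c]" "\<lambda>u. (butlast u, last u)"])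
      (auto simp: V_snoc V_butlast V_last_le, (metis V_snoc append_butlast_last_id le_SucI V_nonempty)+)
  then show ?thesis by (simp add: sum.Sigma)
qed

lemma sum_Cons:
  assumes "n \<ge> 1"
  shows "(\<Sum>u\<in>V (Suc n). f u) = (\<Sum>v\<in>V n. \<Sum>a\<in>{0..m} - {hd v}. f (a # v))"
proof -
  have "(\<Sum>u\<in>V (Suc n). f u) = (\<Sum>(v, c)\<in>(SIGMA v:V n. {0..m} - {hd v}). f (c # v))"
    using V_nonempty assms
    by (intro sum.reindex_bij_witness[of _ "\<lambda>(v, c). c # v" "\<lambda>u. (tl u, hd u)"])
      (auto simp: V_Cons V_tl V_hd_le, (metis V_Cons list.collapse le_SucI V_nonempty)+)
  then show ?thesis by (simp add: sum.Sigma)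
qed

lemma card_V: "card (V (Suc n)) = (m + 1) * m ^ n"
proof (induction n)
  case 0
  then show ?case by (simp add: V_1 card_image inj_on_def)
next
  case (Suc n)
  have "card (V (Suc (Suc n))) = (\<Sum>v\<in>V (Suc n). \<Sum>c\<in>{0..m} - {last v}. 1)"
    using sum_snoc[of "Suc n" "\<lambda>_. 1::nat"] by simp
  also have "\<dots> = (\<Sum>v\<in>V (Suc n). m)"
    by (rule sum.cong) (auto simp: V_last_le)
  finally show ?case by (simp add: Suc algebra_simps)
qed

text \<open>
  \<open>phi\<close> sends a vertex to the sum of the arcs leaving it and \<open>psi\<close> sends an arc to its head, an
  arc of one Kautz graph being a vertex of the next. So \<open>psi \<circ> phi\<close> and \<open>phi \<circ> psi\<close> are the
  adjacency operators (\<open>shift\<close>) of two consecutive Kautz graphs.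
\<close>
definition phi :: "(nat list \<Rightarrow>\<^sub>0 int) \<Rightarrow> nat list \<Rightarrow>\<^sub>0 int" where
  "phi = frag_extend (\<lambda>w. \<Sum>c\<in>{0..m} - {last w}. frag_of (w @ [c]))"

definition shift :: "(nat list \<Rightarrow>\<^sub>0 int) \<Rightarrow> nat list \<Rightarrow>\<^sub>0 int" where
  "shift = frag_extend (\<lambda>w. \<Sum>c\<in>{0..m} - {last w}. frag_of (tl w @ [c]))"

definition psi :: "(nat list \<Rightarrow>\<^sub>0 int) \<Rightarrow> nat list \<Rightarrow>\<^sub>0 int" where
  "psi = frag_extend (\<lambda>w. frag_of (tl w))"

text \<open>Every vertex has out-degree \<open>m\<close>, so the sum in \<open>laplacian_at\<close>
  becomes the adjacency operator minus \<open>m\<close>.\<close>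

definition lapl :: "(nat list \<Rightarrow>\<^sub>0 int) \<Rightarrow> nat list \<Rightarrow>\<^sub>0 int" where
  "lapl x = shift x - frag_cmul (int m) x"

text \<open>Explicit form of the lattice divided out in \<open>critical_group\<close>. The Laplacian
  at the root is included as well; \<open>generate_eq_rel\<close> shows that this gives the same
  subgroup.\<close>

definition rel :: "nat \<Rightarrow> nat list \<Rightarrow> (nat list \<Rightarrow>\<^sub>0 int) set" where
  "rel n r = {lapl y + frag_cmul t (frag_of r) | y t. y \<in> frags (V n)}"

lemma phi_linear:
  "phi 0 = 0" "phi (x + y) = phi x + phi y" "phi (x - y) = phi x - phi y"
  "phi (frag_cmul k x) = frag_cmul k (phi x)"
  by (simp_all add: phi_def frag_extend_linear)

lemma psi_linear:
  "psi 0 = 0" "psi (x + y) = psi x + psi y" "psi (x - y) = psi x - psi y"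
  "psi (frag_cmul k x) = frag_cmul k (psi x)"
  by (simp_all add: psi_def frag_extend_linear)

lemma shift_linear:
  "shift 0 = 0" "shift (x + y) = shift x + shift y" "shift (x - y) = shift x - shift y"
  "shift (frag_cmul k x) = frag_cmul k (shift x)"
  by (simp_all add: shift_def frag_extend_linear)

lemma lapl_linear:
  "lapl 0 = 0" "lapl (x + y) = lapl x + lapl y" "lapl (x - y) = lapl x - lapl y"
  "lapl (frag_cmul k x) = frag_cmul k (lapl x)"
  by (simp_all add: lapl_def shift_linear frag_cmul_distrib2 frag_cmul_diff_distrib2 mult.commute)

lemma phi_frags: "n \<ge> 1 \<Longrightarrow> x \<in> frags (V n) \<Longrightarrow> phi x \<in> frags (V (Suc n))"
  unfolding phi_def
  by (rule frag_extend_closed[of _ "V n"])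
    (auto simp: add_closed_frags frags_def[of "V n"] V_snoc intro!: add_closed_sum)

lemma psi_frags: "x \<in> frags (V (Suc n)) \<Longrightarrow> psi x \<in> frags (V n)"
  unfolding psi_def
  by (rule frag_extend_closed[of _ "V (Suc n)"])
    (auto simp: add_closed_frags frags_def[of "V (Suc n)"] V_tl)

lemma psi_phi: "n \<ge> 1 \<Longrightarrow> x \<in> frags (V n) \<Longrightarrow> psi (phi x) = shift x"
  unfolding psi_def phi_def shift_def frag_extend_frag_extend
  by (rule frag_extend_eq_on_frags, assumption) (auto simp: frag_extend_finite_sum V_nonempty)

lemma phi_psi:
  assumes "n \<ge> 1" "x \<in> frags (V (Suc n))"
  shows "phi (psi x) = shift x"
  unfolding psi_def phi_def shift_def frag_extend_frag_extend
proof (rule frag_extend_eq_on_frags[OF assms(2)])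
  fix v assume "v \<in> V (Suc n)"
  then have "tl v \<noteq> []" using V_nonempty[OF V_tl] assms(1) by blast
  then have "last (tl v) = last v" by (cases v) auto
  then show "frag_extend (\<lambda>w. \<Sum>c\<in>{0..m} - {last w}. frag_of (w @ [c])) (frag_of (tl v))
      = (\<Sum>c\<in>{0..m} - {last v}. frag_of (tl v @ [c]))" by simp
qed

lemma shift_frags: "n \<ge> 1 \<Longrightarrow> x \<in> frags (V n) \<Longrightarrow> shift x \<in> frags (V n)"
  by (metis psi_phi psi_frags phi_frags)

lemma lapl_frags: "n \<ge> 1 \<Longrightarrow> x \<in> frags (V n) \<Longrightarrow> lapl x \<in> frags (V n)"
  unfolding lapl_def by (intro add_closed_rules add_closed_frags shift_frags)

lemma rel_frags: "n \<ge> 1 \<Longrightarrow> r \<in> V n \<Longrightarrow> rel n r \<subseteq> frags (V n)"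
  unfolding rel_def by (auto intro!: add_closed_rules add_closed_frags lapl_frags)

lemma lapl_in_rel: "y \<in> frags (V n) \<Longrightarrow> lapl y \<in> rel n r"
  unfolding rel_def by (force intro: exI[of _ 0])

lemma root_in_rel: "frag_of r \<in> rel n r"
  unfolding rel_def using add_closed_zero[OF add_closed_frags]
  by (auto intro!: exI[of _ 0] exI[of _ 1] simp: lapl_linear)

lemma add_closed_rel: "add_closed (rel n r)"
  unfolding add_closed_def
proof (intro conjI ballI)
  show "0 \<in> rel n r"
    using lapl_in_rel[OF add_closed_zero[OF add_closed_frags]] by (simp add: lapl_linear)
  fix a b assume "a \<in> rel n r" "b \<in> rel n r"
  then obtain y t y' t' where "a = lapl y + frag_cmul t (frag_of r)" "y \<in> frags (V n)"
    "b = lapl y' + frag_cmul t' (frag_of r)" "y' \<in> frags (V n)"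
    unfolding rel_def by blast
  then have "a - b = lapl (y - y') + frag_cmul (t - t') (frag_of r)" "y - y' \<in> frags (V n)"
    by (auto simp: lapl_linear frag_cmul_diff_distrib add_closed_frags add_closed_diff)
  then show "a - b \<in> rel n r" unfolding rel_def by blast
qed

text \<open>The difference is \<open>lapl x\<close>, because \<open>phi (psi x)\<close> is
  \<open>shift x\<close>. This congruence governs the passage from one graph to the next.\<close>

lemma phi_psi_minus_cmul_rel:
  assumes "n \<ge> 1" "x \<in> frags (V (Suc n))"
  shows "phi (psi x) - frag_cmul (int m) x \<in> rel (Suc n) r"
  using lapl_in_rel[OF assms(2)] phi_psi[OF assms] by (simp add: lapl_def)

text \<open>\<open>phi\<close> commutes with the Laplacians, because
  \<open>phi (psi (phi y))\<close> can be bracketed in two ways, and it sends the old root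
  \<open>tl r\<close> to \<open>m\<close> times the new root modulo relations. So it descends to the
  critical groups.\<close>

lemma phi_rel:
  assumes "n \<ge> 1" "r \<in> V (Suc n)" "x \<in> rel n (tl r)"
  shows "phi x \<in> rel (Suc n) r"
proof -
  obtain y t where x: "x = lapl y + frag_cmul t (frag_of (tl r))" "y \<in> frags (V n)"
    using assms unfolding rel_def by blast
  have 1: "phi (lapl y) = lapl (phi y)"
    using psi_phi[OF assms(1) x(2)] phi_psi[OF assms(1) phi_frags[OF assms(1) x(2)]]
    by (simp add: lapl_def phi_linear)
  have "phi (psi (frag_of r)) - frag_cmul (int m) (frag_of r) \<in> rel (Suc n) r"
    using assms by (intro phi_psi_minus_cmul_rel) auto
  then have "phi (frag_of (tl r)) \<in> rel (Suc n) r"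
    using add_closed_cong[OF add_closed_rel] add_closed_cmul[OF add_closed_rel root_in_rel]
    by (simp add: psi_def)
  then show ?thesis
    unfolding x(1) phi_linear 1
    by (intro add_closed_add add_closed_cmul lapl_in_rel phi_frags add_closed_rel assms x)
qed

text \<open>An arc leaves exactly one vertex, so only the term of \<open>w\<close> contributes to
  this coefficient.\<close>

lemma lookup_phi:
  assumes "c \<in> {0..m} - {last w}"
  shows "Poly_Mapping.lookup (phi x) (w @ [c]) = Poly_Mapping.lookup x w"
  using subset_UNIV[of "Poly_Mapping.keys x"]
proof (induction x rule: frag_induction)
  case (diff a b)
  then show ?case by (simp add: phi_linear lookup_minus)
next
  case (one v)
  have "(\<Sum>d\<in>{0..m} - {last v}. if w = v \<and> c = d then 1 else 0) = (if w = v then 1 else (0::int))"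
    using assms by auto
  then show ?case by (simp add: phi_def lookup_sum)
qed (auto simp: phi_linear)

lemma third_letter: obtains c where "c \<le> m" "c \<noteq> a" "c \<noteq> b"
proof -
  have "card {a, b} < card {0..m}" using m_ge by (simp add: card_insert_if)
  then have "\<not> {0..m} \<subseteq> {a, b}" using card_mono[of "{a, b}" "{0..m}"] by auto
  then show ?thesis using that by (metis atLeastAtMost_iff insertI1 insertI2 subsetI)
qed

text \<open>Writing \<open>lapl y\<close> as \<open>phi (psi y)\<close> minus \<open>m\<close> times
  \<open>y\<close> turns the hypothesis into \<open>my\<close>. Comparing coefficients shows that
  \<open>b\<close> and \<open>t\<close> are divisible by \<open>m\<close>; dividing by
  \<open>m\<close> and applying \<open>psi\<close> exhibits \<open>x\<close> as a relation.\<close>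

lemma phi_rel_inject:
  assumes n: "n \<ge> 1" and r: "r \<in> V (Suc n)" and x: "x \<in> frags (V n)" "phi x \<in> rel (Suc n) r"
  shows "x \<in> rel n (tl r)"
proof -
  obtain y t where y: "phi x = lapl y + frag_cmul t (frag_of r)" "y \<in> frags (V (Suc n))"
    using x unfolding rel_def by blast
  define b where "b = psi y - x"
  have b: "b \<in> frags (V n)"
    unfolding b_def by (intro add_closed_rules add_closed_frags psi_frags y x)
  have my: "frag_cmul (int m) y = phi b + frag_cmul t (frag_of r)"
    using y phi_psi[OF n y(2)] by (simp add: b_def phi_linear lapl_def algebra_simps)
  have coeff: "int m * Poly_Mapping.lookup y (w @ [c]) =
      Poly_Mapping.lookup b w + (if w @ [c] = r then t else 0)"
    if "c \<in> {0..m} - {last w}" for w c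
    using arg_cong[OF my, of "\<lambda>z. Poly_Mapping.lookup z (w @ [c])"] lookup_phi[OF that, of b]
    by (simp add: lookup_add split: if_splits)
  have dvd_b: "int m dvd Poly_Mapping.lookup b w" for w
  proof -
    \<comment> \<open>A third letter gives an arc leaving \<open>w\<close> that is not the root, so
      that \<open>t\<close> does not enter its coefficient.\<close>
    obtain c where c: "c \<le> m" "c \<noteq> last w" "c \<noteq> last r" by (rule third_letter)
    then have "w @ [c] \<noteq> r" by auto
    then have "Poly_Mapping.lookup b w = int m * Poly_Mapping.lookup y (w @ [c])"
      using coeff[of c w] c by simp
    then show ?thesis by simp
  qed
  have r': "r = butlast r @ [last r]" "butlast r \<in> V n"
    using V_nonempty[OF r] V_butlast[OF r] by auto
  then have "last r \<in> {0..m} - {last (butlast r)}"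
    using r n V_nonempty[OF r'(2)] V_snoc[of "butlast r" "last r" n] by auto
  from coeff[OF this] r' have "int m * Poly_Mapping.lookup y r = Poly_Mapping.lookup b (butlast r) + t"
    by simp
  then have "int m dvd t" using dvd_b by (metis dvd_add_right_iff dvd_triv_left)
  then obtain t' where t: "t = int m * t'" by blast
  obtain z where z: "b = frag_cmul (int m) z" "Poly_Mapping.keys z \<subseteq> Poly_Mapping.keys b"
    using dvd_b frag_dvd by blast
  have zc: "z \<in> frags (V n)" using z(2) b by (auto simp: frags_def)
  have "frag_cmul (int m) y = frag_cmul (int m) (phi z + frag_cmul t' (frag_of r))"
    using my by (simp add: z(1) t phi_linear frag_cmul_distrib2)
  then have "y = phi z + frag_cmul t' (frag_of r)"
    using m_ge by (simp add: frag_cmul_cancel)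
  then have "psi y = shift z + frag_cmul t' (frag_of (tl r))"
    using psi_phi[OF n zc] by (simp add: psi_linear) (simp add: psi_def)
  then have "x = lapl z + frag_cmul t' (frag_of (tl r))"
    using z(1) by (simp add: b_def lapl_def algebra_simps)
  then show ?thesis using zc unfolding rel_def by blast
qed

subsection \<open>Lower bound for the order\<close>

definition spare :: "nat \<Rightarrow> nat \<Rightarrow> nat" where
  "spare a b = (SOME c. c \<le> m \<and> c \<noteq> a \<and> c \<noteq> b)"

lemma spare: "spare a b \<le> m" "spare a b \<noteq> a" "spare a b \<noteq> b"
proof -
  have "\<exists>c. c \<le> m \<and> c \<noteq> a \<and> c \<noteq> b" using third_letter by metis
  then have "spare a b \<le> m \<and> spare a b \<noteq> a \<and> spare a b \<noteq> b"
    unfolding spare_def by (rule someI_ex)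
  then show "spare a b \<le> m" "spare a b \<noteq> a" "spare a b \<noteq> b" by auto
qed

text \<open>
  Modulo \<open>m\<close> and the image of \<open>phi\<close>, the arcs leaving a vertex are subject only to their sum being
  zero, so one arc per vertex is redundant; avoiding the last letter of \<open>r\<close> makes sure that this is
  not the root.
\<close>
definition free_arcs :: "nat \<Rightarrow> nat list \<Rightarrow> nat list set" where
  "free_arcs n r = V (Suc n) - insert r ((\<lambda>w. w @ [spare (last w) (last r)]) ` V n)"

lemma spare_arc_in_V: "w \<in> V n \<Longrightarrow> w @ [spare (last w) b] \<in> V (Suc n)"
  by (auto simp: V_snoc spare)

lemma card_free_arcs:
  assumes "r \<in> V (Suc n)"
  shows "card (free_arcs n r) + card (V n) + 1 = card (V (Suc n))"
proof -
  let ?f = "\<lambda>w. w @ [spare (last w) (last r)]"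
  have avoid: "w @ [spare (last w) (last r)] \<noteq> r" for w
    using spare(3)[of "last w" "last r"] by (auto dest: arg_cong[of _ _ last])
  then have "r \<notin> ?f ` V n" by (simp add: image_iff avoid[symmetric])
  then have "card (insert r (?f ` V n)) = card (V n) + 1"
    by (simp add: card_image inj_on_def)
  moreover have "insert r (?f ` V n) \<subseteq> V (Suc n)" using assms spare_arc_in_V by auto
  ultimately show ?thesis unfolding free_arcs_def
    using card_mono[of "V (Suc n)" "insert r (?f ` V n)"]
    by (subst card_Diff_subset) auto
qed

lemma finite_free_arcs [simp]: "finite (free_arcs n r)"
  by (simp add: free_arcs_def)

text \<open>Away from \<open>r\<close>, the relation says that the coefficient of the combination at
  an arc \<open>w @ [c]\<close> is that of \<open>b\<close> at \<open>w\<close>, modulo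
  \<open>m\<close>. The omitted arc leaving \<open>w\<close> has coefficient zero, so
  \<open>m\<close> divides the coefficient of \<open>b\<close> at \<open>w\<close> and hence that of
  every free arc leaving \<open>w\<close>.\<close>

lemma comb_free_arcs_rel:
  assumes n: "n \<ge> 1" and r: "r \<in> V (Suc n)" and x: "x \<in> frags (V n)"
    and s: "phi x + comb (free_arcs n r) s \<in> rel (Suc n) r" and e: "e \<in> free_arcs n r"
  shows "int m dvd s e"
proof -
  obtain y t where y: "phi x + comb (free_arcs n r) s = lapl y + frag_cmul t (frag_of r)"
      "y \<in> frags (V (Suc n))"
    using s unfolding rel_def by blast
  define b where "b = psi y - x"
  have cb: "comb (free_arcs n r) s = phi b - frag_cmul (int m) y + frag_cmul t (frag_of r)"
    using y phi_psi[OF n y(2)] by (simp add: b_def phi_linear lapl_def algebra_simps)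
  have coeff: "(if w @ [c] \<in> free_arcs n r then s (w @ [c]) else 0) =
      Poly_Mapping.lookup b w - int m * Poly_Mapping.lookup y (w @ [c]) + (if w @ [c] = r then t else 0)"
    if "c \<in> {0..m} - {last w}" for w c
    using arg_cong[OF cb, of "\<lambda>z. Poly_Mapping.lookup z (w @ [c])"] lookup_phi[OF that, of b]
    by (simp add: lookup_add lookup_minus lookup_comb split: if_splits)
  define w where "w = butlast e"
  have eV: "e \<in> V (Suc n)" using e by (simp add: free_arcs_def)
  have w: "w \<in> V n" "e = w @ [last e]" using V_nonempty[OF eV] V_butlast[OF eV] by (auto simp: w_def)
  have "w \<noteq> []" using V_nonempty w n by blast
  let ?q = "spare (last w) (last r)"
  have "w @ [?q] \<noteq> r"
    using spare(3)[of "last w" "last r"] by (auto dest: arg_cong[of _ _ last])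
  moreover have "w @ [?q] \<notin> free_arcs n r" using w by (auto simp: free_arcs_def)
  ultimately have "Poly_Mapping.lookup b w = int m * Poly_Mapping.lookup y (w @ [?q])"
    using coeff[of ?q w] spare by simp
  moreover have "s e = Poly_Mapping.lookup b w - int m * Poly_Mapping.lookup y e"
  proof -
    have "last e \<in> {0..m} - {last w}" using eV w \<open>w \<noteq> []\<close> V_snoc[of w "last e" n] by auto
    from coeff[OF this] show ?thesis using e w by (auto simp: free_arcs_def simp flip: w(2))
  qed
  ultimately show ?thesis by simp
qed

text \<open>The new representatives are \<open>phi x\<close> plus digits from 0 to
  \<open>m - 1\<close> on the free arcs. If two of them are congruent, their digits agree by
  \<open>comb_free_arcs_rel\<close>, and then \<open>x\<close> agrees by
  \<open>phi_rel_inject\<close>.\<close>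

lemma separated_step:
  assumes n: "n \<ge> 1" and r: "r \<in> V (Suc n)"
    and R: "R \<subseteq> frags (V n)" "separated (rel n (tl r)) R"
  shows "\<exists>R' \<subseteq> frags (V (Suc n)). separated (rel (Suc n) r) R' \<and>
    card R' = card R * m ^ card (free_arcs n r)"
proof -
  let ?F = "free_arcs n r"
  let ?f = "\<lambda>(x, s). phi x + comb ?F s"
  let ?P = "R \<times> (?F \<rightarrow>\<^sub>E {0..<int m})"
  have inj: "p = q" if pq: "p \<in> ?P" "q \<in> ?P" "?f p - ?f q \<in> rel (Suc n) r" for p q
  proof -
    obtain x s x' s' where p: "p = (x, s)" "q = (x', s')" by (metis surj_pair)
    have xc: "x \<in> R" "x' \<in> R" "x - x' \<in> frags (V n)"
      using pq(1,2) R(1) by (auto simp: p intro!: add_closed_diff add_closed_frags)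
    have "comb ?F s - comb ?F s' = comb ?F (\<lambda>e. s e - s' e)"
      by (simp add: comb_def frag_cmul_diff_distrib sum_subtractf)
    then have d: "phi (x - x') + comb ?F (\<lambda>e. s e - s' e) \<in> rel (Suc n) r"
      using pq(3) by (simp add: p phi_linear algebra_simps)
    have "s e = s' e" if "e \<in> ?F" for e
      using comb_free_arcs_rel[OF n r xc(3) d that] pq(1,2) that
      by (intro mod_eq_on_interval[of _ "int m"]) (auto simp: p PiE_iff)
    then have ss: "s = s'" using pq(1,2) by (auto simp: p intro: PiE_ext)
    then have "phi (x - x') \<in> rel (Suc n) r" using d by (simp add: comb_def)
    then have "x - x' \<in> rel n (tl r)" by (rule phi_rel_inject[OF n r xc(3)])
    then show "p = q" using R(2) xc ss by (auto simp: separated_def p)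
  qed
  have "?f ` ?P \<subseteq> frags (V (Suc n))"
    using R(1) n by (auto intro!: add_closed_add add_closed_frags phi_frags comb_frags
        simp: free_arcs_def)
  moreover have "card ?P = card R * m ^ card ?F"
    by (simp add: card_cartesian_product card_PiE)
  moreover have "separated (rel (Suc n) r) (?f ` ?P)" "card (?f ` ?P) = card ?P"
    using separated_image[OF add_closed_zero[OF add_closed_rel], of ?P ?f "Suc n" r] inj by auto
  ultimately show ?thesis by (intro exI[of _ "?f ` ?P"]) simp
qed

section \<open>Lower bound for the complete digraph on the letters\<close>

lemma lapl_letter: "a \<le> m \<Longrightarrow>
  lapl (frag_of [a]) = (\<Sum>c\<in>{0..m}. frag_of [c]) - frag_cmul (int (m + 1)) (frag_of [a])"
  by (simp add: lapl_def shift_def sum_diff1 frag_cmul_distrib algebra_simps)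

lemma lookup_lapl_letters:
  assumes "y \<in> frags (V 1)" "a \<le> m"
  shows "Poly_Mapping.lookup (lapl y) [a] =
    (\<Sum>v\<in>V 1. Poly_Mapping.lookup y v) - int (m + 1) * Poly_Mapping.lookup y [a]"
proof -
  have "Poly_Mapping.keys y \<subseteq> V 1" using assms(1) by (simp add: frags_def)
  then show ?thesis
  proof (induction y rule: frag_induction)
    case (one v)
    then obtain b where b: "v = [b]" "b \<le> m" by (auto simp: V_1)
    have "(\<Sum>c\<in>{0..m}. if a = c then 1 else 0) = (1::int)" using assms by simp
    with b one show ?case by (simp add: lapl_letter lookup_minus lookup_sum)
  next
    case (diff x y)
    then show ?case by (simp add: lapl_linear lookup_minus sum_subtractf algebra_simps)
  qed (simp add: lapl_linear)
qed

text \<open>Besides the root a second letter is dropped, since the sum of all letters vanishes in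
  the critical group; \<open>m - 1\<close> of the \<open>m + 1\<close> letters remain.\<close>

definition free_letters :: "nat list \<Rightarrow> nat list set" where
  "free_letters r = V 1 - {r, [spare (hd r) (hd r)]}"

lemma finite_free_letters [simp]: "finite (free_letters r)"
  by (simp add: free_letters_def)

lemma card_free_letters:
  assumes "r \<in> V 1"
  shows "card (free_letters r) = m - 1"
proof -
  have "[spare (hd r) (hd r)] \<noteq> r" using spare(2)[of "hd r" "hd r"] by (auto dest: arg_cong[of _ _ hd])
  moreover have "card (V 1) = m + 1" using card_V[of 0] by simp
  moreover have "{r, [spare (hd r) (hd r)]} \<subseteq> V 1"
    using assms spare(1) by (auto simp: V_1)
  ultimately show ?thesis unfolding free_letters_def
    by (subst card_Diff_subset) auto
qed

lemma separated_base:
  assumes r: "r \<in> V 1"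
  shows "\<exists>R \<subseteq> frags (V 1). separated (rel 1 r) R \<and> card R = (m + 1) ^ (m - 1)"
proof -
  let ?F = "free_letters r"
  let ?P = "?F \<rightarrow>\<^sub>E {0..<int (m + 1)}"
  let ?q = "spare (hd r) (hd r)"
  have inj: "s = s'" if ss: "s \<in> ?P" "s' \<in> ?P" "comb ?F s - comb ?F s' \<in> rel 1 r" for s s'
  proof -
    obtain y t where y: "comb ?F s - comb ?F s' = lapl y + frag_cmul t (frag_of r)" "y \<in> frags (V 1)"
      using ss(3) unfolding rel_def by blast
    define D where "D = (\<Sum>v\<in>V 1. Poly_Mapping.lookup y v)"
    have coeff: "(if [a] \<in> ?F then s [a] - s' [a] else 0) =
        D - int (m + 1) * Poly_Mapping.lookup y [a] + (if [a] = r then t else 0)" if "a \<le> m" for a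
      using arg_cong[OF y(1), of "\<lambda>z. Poly_Mapping.lookup z [a]"] lookup_lapl_letters[OF y(2) that]
      by (simp add: lookup_add lookup_minus lookup_comb D_def split: if_splits)
    have "[?q] \<noteq> r" using spare(2)[of "hd r" "hd r"] by (auto dest: arg_cong[of _ _ hd])
    \<comment> \<open>At the dropped letter the left side of \<open>coeff\<close> is zero. So
      \<open>m + 1\<close> divides \<open>D\<close>, and with it the difference of the digits at
      each free letter.\<close>
    then have "D = int (m + 1) * Poly_Mapping.lookup y [?q]"
      using coeff[OF spare(1)[of "hd r" "hd r"]] by (simp add: free_letters_def)
    then have D: "int (m + 1) dvd D" by simp
    have "s e = s' e" if e: "e \<in> ?F" for e
    proof -
      obtain a where a: "e = [a]" "a \<le> m" using e by (auto simp: free_letters_def V_1)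
      have "e \<noteq> r" using e by (simp add: free_letters_def)
      then have "s e - s' e = D - int (m + 1) * Poly_Mapping.lookup y e"
        using coeff[OF a(2)] e by (simp add: a)
      then have "int (m + 1) dvd s e - s' e" using D by simp
      then show ?thesis using ss e by (intro mod_eq_on_interval[of _ "int (m + 1)"]) (auto simp: PiE_iff)
    qed
    then show ?thesis using ss by (auto intro: PiE_ext)
  qed
  have "comb ?F ` ?P \<subseteq> frags (V 1)"
    by (auto intro!: comb_frags simp: free_letters_def)
  moreover have "card ?P = (m + 1) ^ (m - 1)"
    using card_free_letters[OF r] by (simp add: card_PiE nat_add_distrib)
  moreover have "separated (rel 1 r) (comb ?F ` ?P)" "card (comb ?F ` ?P) = card ?P"
    using separated_image[OF add_closed_zero[OF add_closed_rel], of ?P "comb ?F" 1 r] inj by auto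
  ultimately show ?thesis by (intro exI[of _ "comb ?F ` ?P"]) simp
qed

text \<open>Each step raises the exponent of \<open>m\<close> by the number of free arcs, which is
  the increase in the number of vertices minus one, so the total telescopes. It is stated additively
  to avoid truncated subtraction.\<close>

lemma separated_exists:
  assumes "r \<in> V (Suc n)"
  shows "\<exists>R \<subseteq> frags (V (Suc n)). \<exists>e. separated (rel (Suc n) r) R \<and>
    card R = (m + 1) ^ (m - 1) * m ^ e \<and> e + m + Suc n = (m + 1) * m ^ n"
  using assms
proof (induction n arbitrary: r)
  case 0
  then obtain R where "R \<subseteq> frags (V 1)" "separated (rel 1 r) R" "card R = (m + 1) ^ (m - 1)"
    using separated_base[of r] by auto
  then show ?case by (intro exI[of _ R] conjI exI[of _ 0]) auto
next
  case (Suc n)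
  obtain R e where R: "R \<subseteq> frags (V (Suc n))" "separated (rel (Suc n) (tl r)) R"
    "card R = (m + 1) ^ (m - 1) * m ^ e" "e + m + Suc n = (m + 1) * m ^ n"
    using Suc.IH[OF V_tl[OF Suc.prems]] by blast
  obtain R' where R': "R' \<subseteq> frags (V (Suc (Suc n)))" "separated (rel (Suc (Suc n)) r) R'"
    "card R' = card R * m ^ card (free_arcs (Suc n) r)"
    using separated_step[OF _ Suc.prems R(1,2)] by auto
  have "card R' = (m + 1) ^ (m - 1) * m ^ (e + card (free_arcs (Suc n) r))"
    using R' R by (simp add: power_add)
  moreover have "e + card (free_arcs (Suc n) r) + m + Suc (Suc n) = (m + 1) * m ^ Suc n"
    using card_free_arcs[OF Suc.prems] R(4) unfolding card_V by linarith
  ultimately show ?case using R' by blast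
qed

subsection \<open>Generators\<close>

text \<open>Such a set is what \<open>cyclic_power d a\<close> can cover in the critical group. The
  bound on the cardinality is an inequality because it then passes to images under
  \<open>phi\<close> and \<open>lift\<close> without an injectivity argument.\<close>

definition torsion_family ::
    "nat \<Rightarrow> nat list \<Rightarrow> nat \<Rightarrow> nat \<Rightarrow> (nat list \<Rightarrow>\<^sub>0 int) set \<Rightarrow> bool" where
  "torsion_family n r d a B \<longleftrightarrow> B \<subseteq> frags (V n) \<and> finite B \<and> card B \<le> a \<and>
    (\<forall>x\<in>B. frag_cmul (int d) x \<in> rel n r)"

definition block_size :: "nat \<Rightarrow> nat \<Rightarrow> nat" where
  "block_size n i = m ^ (n - 2 - i) * (m - 1)\<^sup>2 * (m + 1)"

text \<open>\<open>C\<close>, \<open>B\<close> and the \<open>A i\<close> are destined for the three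
  kinds of cyclic factors in the theorem. The last clause says that together they generate the
  quotient by \<open>rel n r\<close>, phrased through subgroups containing the relations.\<close>

definition generating ::
    "nat \<Rightarrow> nat list \<Rightarrow> (nat list \<Rightarrow>\<^sub>0 int) set \<Rightarrow> (nat list \<Rightarrow>\<^sub>0 int) set \<Rightarrow>
      (nat \<Rightarrow> (nat list \<Rightarrow>\<^sub>0 int) set) \<Rightarrow> bool" where
  "generating n r C B A \<longleftrightarrow>
    torsion_family n r (m + 1) (m - 1) C \<and>
    torsion_family n r (m ^ (n - 1)) (m\<^sup>2 - 2) B \<and>
    (\<forall>i\<in>{1..n - 2}. torsion_family n r (m ^ i) (block_size n i) (A i)) \<and>
    (\<forall>S. add_closed S \<longrightarrow> rel n r \<subseteq> S \<longrightarrow> C \<subseteq> S \<longrightarrow> B \<subseteq> S \<longrightarrow>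
      (\<forall>i\<in>{1..n - 2}. A i \<subseteq> S) \<longrightarrow> frags (V n) \<subseteq> S)"

lemma torsion_family_phi:
  assumes "n \<ge> 1" "r \<in> V (Suc n)" "torsion_family n (tl r) d a B"
  shows "torsion_family (Suc n) r d a (phi ` B)"
proof -
  have "frag_cmul (int d) (phi x) \<in> rel (Suc n) r" if "x \<in> B" for x
    using phi_rel[OF assms(1,2)] assms(3) that
    by (auto simp: torsion_family_def simp flip: phi_linear(4))
  then show ?thesis
    using assms phi_frags card_image_le[of B phi]
    by (fastforce simp: torsion_family_def)
qed

text \<open>A fixed letter that may precede \<open>w\<close>. It depends on \<open>hd w\<close>
  alone, hence is stable under appending letters to a nonempty string.\<close>

definition pre :: "nat list \<Rightarrow> nat" where
  "pre w = spare (hd w) (hd w)"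

text \<open>
  In the critical group \<open>m\<close> times \<open>lift x\<close> is \<open>phi x\<close>; hence \<open>phi\<close> preserves annihilators
  and \<open>lift\<close> multiplies them by \<open>m\<close>.
\<close>
definition lift :: "(nat list \<Rightarrow>\<^sub>0 int) \<Rightarrow> nat list \<Rightarrow>\<^sub>0 int" where
  "lift = frag_extend (\<lambda>w. frag_of (pre w # w))"

lemma lift_linear:
  "lift 0 = 0" "lift (x + y) = lift x + lift y" "lift (x - y) = lift x - lift y"
  "lift (frag_cmul k x) = frag_cmul k (lift x)"
  by (simp_all add: lift_def frag_extend_linear)

lemma pre: "pre w \<le> m" "pre w \<noteq> hd w"
  by (simp_all add: pre_def spare)

lemma pre_snoc: "y \<noteq> [] \<Longrightarrow> pre (y @ [c]) = pre y"
  by (simp add: pre_def)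

lemma lift_frags: "x \<in> frags (V n) \<Longrightarrow> lift x \<in> frags (V (Suc n))"
  unfolding lift_def
  by (rule frag_extend_closed[of _ "V n"])
    (auto simp: add_closed_frags frags_def[of "V n"] V_Cons pre)

lemma psi_lift: "psi (lift x) = x"
  unfolding psi_def lift_def frag_extend_frag_extend by (simp flip: frag_expansion)

lemma lift_rel: "n \<ge> 1 \<Longrightarrow> x \<in> frags (V n) \<Longrightarrow>
    phi x - frag_cmul (int m) (lift x) \<in> rel (Suc n) r"
  using phi_psi_minus_cmul_rel[OF _ lift_frags, of n x r] by (simp add: psi_lift)

lemma torsion_family_lift:
  assumes "n \<ge> 1" "r \<in> V (Suc n)" "torsion_family n (tl r) d a B"
  shows "torsion_family (Suc n) r (m * d) a (lift ` B)"
proof -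
  have "frag_cmul (int (m * d)) (lift x) \<in> rel (Suc n) r" if "x \<in> B" for x
  proof -
    have x: "x \<in> frags (V n)" "frag_cmul (int d) x \<in> rel n (tl r)"
      using assms(3) that by (auto simp: torsion_family_def)
    have "phi (frag_cmul (int d) x) - frag_cmul (int m) (lift (frag_cmul (int d) x)) \<in> rel (Suc n) r"
      by (intro lift_rel assms add_closed_cmul add_closed_frags x)
    then show ?thesis
      using add_closed_cong[OF add_closed_rel] phi_rel[OF assms(1,2) x(2)]
      by (simp add: lift_linear)
  qed
  then show ?thesis
    using assms lift_frags card_image_le[of B lift]
    by (fastforce simp: torsion_family_def)
qed

lemma add_closed_vimage_phi: "add_closed S \<Longrightarrow> add_closed {x \<in> frags I. phi x \<in> S}"
  using add_closed_frags[of I] by (simp add: add_closed_def phi_linear)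

lemma add_closed_vimage_lift: "add_closed S \<Longrightarrow> add_closed {x \<in> frags I. lift x \<in> S}"
  using add_closed_frags[of I] by (simp add: add_closed_def lift_linear)

text \<open>Modulo relations, \<open>m\<close> times \<open>x\<close> is the value of
  \<open>phi\<close> at \<open>psi x\<close>.\<close>

lemma cmul_mem:
  assumes "n \<ge> 1" "rel (Suc n) r \<subseteq> S" "add_closed S" "\<And>x. x \<in> frags (V n) \<Longrightarrow> phi x \<in> S"
    and "x \<in> frags (V (Suc n))"
  shows "frag_cmul (int m) x \<in> S"
  using phi_psi_minus_cmul_rel[OF assms(1,5), of r] assms(2) assms(4)[OF psi_frags[OF assms(5)]]
    add_closed_cong[OF assms(3)] by blast

section \<open>Generators for strings of length one and two\<close>

lemma sum_letters_rel:
  assumes r: "r \<in> V 1"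
  shows "(\<Sum>c\<in>{0..m}. frag_of [c]) \<in> rel 1 r"
proof -
  obtain k where k: "r = [k]" "k \<le> m" using r by (auto simp: V_1)
  have "lapl (frag_of r) \<in> rel 1 r" using r by (intro lapl_in_rel) auto
  then show ?thesis
    using add_closed_cong[OF add_closed_rel] add_closed_cmul[OF add_closed_rel root_in_rel[of r 1]]
    unfolding k(1) lapl_letter[OF k(2)] by blast
qed

text \<open>The Laplacian at a letter is the sum of all letters minus \<open>m + 1\<close> times
  that letter, and the sum is itself a relation.\<close>

lemma letter_torsion:
  assumes r: "r \<in> V 1" and v: "v \<in> V 1"
  shows "frag_cmul (int (m + 1)) (frag_of v) \<in> rel 1 r"
proof -
  obtain a where a: "v = [a]" "a \<le> m" using v by (auto simp: V_1)
  have "lapl (frag_of v) \<in> rel 1 r" using v by (intro lapl_in_rel) auto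
  then show ?thesis
    using sum_letters_rel[OF r] add_closed_cong[OF add_closed_rel]
    unfolding a(1) lapl_letter[OF a(2)] by blast
qed

text \<open>The root is zero, and the other dropped letter is minus the sum of the remaining ones
  modulo relations. \<open>B\<close> is empty, in accordance with its order \<open>m ^ 0\<close>,
  and \<open>i\<close> ranges over an empty set.\<close>

lemma generating_1:
  assumes r: "r \<in> V 1"
  shows "generating 1 r (frag_of ` free_letters r) {} A"
proof -
  let ?q = "spare (hd r) (hd r)"
  let ?all = "\<Sum>c\<in>{0..m}. frag_of [c]"
  note all = sum_letters_rel[OF r]
  have "torsion_family 1 r (m + 1) (m - 1) (frag_of ` free_letters r)"
    using letter_torsion[OF r] card_free_letters[OF r] card_image_le[of "free_letters r" frag_of]
    by (auto simp: torsion_family_def free_letters_def)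
  moreover have "frags (V 1) \<subseteq> S"
    if S: "add_closed S" "rel 1 r \<subseteq> S" "frag_of ` free_letters r \<subseteq> S" for S
  proof (rule frags_subset[OF S(1)])
    fix v assume v: "v \<in> V 1"
    have rS: "frag_of r \<in> S" using root_in_rel S(2) by blast
    have other: "frag_of [c] \<in> S" if "c \<in> {0..m} - {?q}" for c
      using that S(3) rS by (cases "[c] = r") (auto simp: free_letters_def V_1 image_subset_iff)
    have "?all = frag_of [?q] + (\<Sum>c\<in>{0..m} - {?q}. frag_of [c])"
      using spare(1) by (intro sum.remove) auto
    then have "frag_of [?q] = ?all - (\<Sum>c\<in>{0..m} - {?q}. frag_of [c])"
      by (simp only: add_diff_cancel_right')
    moreover have "(\<Sum>c\<in>{0..m} - {?q}. frag_of [c]) \<in> S"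
      using other S(1) by (intro add_closed_sum) auto
    ultimately have "frag_of [?q] \<in> S"
      using add_closed_diff[OF S(1) subsetD[OF S(2) all]] by simp
    moreover obtain a where "v = [a]" "a \<le> m" using v by (auto simp: V_1)
    ultimately show "frag_of v \<in> S" using other[of a] by (cases "a = ?q") auto
  qed
  ultimately show ?thesis by (auto simp: generating_def torsion_family_def)
qed

lemma generating_2:
  assumes r: "r \<in> V (Suc 1)" and gen: "generating 1 (tl r) C B A"
  shows "generating 2 r (phi ` C)
    ((\<lambda>v. frag_of v + phi (frag_of (tl v))) ` free_arcs 1 r) A'"
    (is "generating 2 r ?C ?B A'")
proof -
  have tlr: "tl r \<in> V 1" using V_tl[OF r] .
  have tor: "frag_cmul (int m) (frag_of v + phi (frag_of (tl v))) \<in> rel 2 r" if v: "v \<in> V 2" for v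
  proof -
    have "tl v \<in> V 1" using V_tl[of v 1] v by (simp add: numeral_2_eq_2)
    from letter_torsion[OF tlr this]
    have "phi (frag_cmul (int (m + 1)) (frag_of (tl v))) \<in> rel 2 r"
      using phi_rel[of 1 r] r by (simp add: numeral_2_eq_2)
    then have 1: "frag_cmul (int m) (phi (frag_of (tl v))) + phi (frag_of (tl v)) \<in> rel 2 r"
      by (simp add: phi_linear frag_cmul_distrib add.commute)
    have "phi (psi (frag_of v)) - frag_cmul (int m) (frag_of v) \<in> rel 2 r"
      using phi_psi_minus_cmul_rel[of 1 "frag_of v" r] v by (simp add: numeral_2_eq_2)
    then have "(frag_cmul (int m) (phi (frag_of (tl v))) + phi (frag_of (tl v)))
        - (phi (psi (frag_of v)) - frag_cmul (int m) (frag_of v)) \<in> rel 2 r"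
      by (rule add_closed_diff[OF add_closed_rel 1])
    then show ?thesis by (simp add: psi_def frag_cmul_distrib2 algebra_simps)
  qed
  have "card (free_arcs 1 r) + (m + 1) + 1 = (m + 1) * m"
    using card_free_arcs[OF r] card_V[of 0] card_V[of 1] by simp
  then have "card (free_arcs 1 r) = m\<^sup>2 - 2" by (simp add: power2_eq_square)
  then have cardB: "card ?B \<le> m\<^sup>2 - 2" using card_image_le[OF finite_free_arcs] by metis
  have "?B \<subseteq> frags (V 2)"
  proof clarify
    fix v assume "v \<in> free_arcs 1 r"
    then have v: "v \<in> V (Suc 1)" by (simp add: free_arcs_def)
    then show "frag_of v + phi (frag_of (tl v)) \<in> frags (V 2)"
      using phi_frags[of 1 "frag_of (tl v)"] V_tl[OF v]
      by (intro add_closed_add add_closed_frags) (auto simp: numeral_2_eq_2)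
  qed
  then have "torsion_family 2 r m (m\<^sup>2 - 2) ?B"
    using tor cardB by (auto simp: torsion_family_def free_arcs_def numeral_2_eq_2)
  moreover have "torsion_family 2 r (m + 1) (m - 1) ?C"
    using torsion_family_phi[of 1 r] r gen by (simp add: generating_def numeral_2_eq_2)
  moreover have "frags (V 2) \<subseteq> S" if S: "add_closed S" "rel 2 r \<subseteq> S" "?C \<subseteq> S" "?B \<subseteq> S" for S
  proof (rule frags_subset[OF S(1)])
    let ?T = "{x \<in> frags (V 1). phi x \<in> S}"
    \<comment> \<open>For strings of length one the order \<open>m ^ (n - 1)\<close> is 1, so
      \<open>B\<close> consists of relations.\<close>
    have "torsion_family 1 (tl r) 1 (m\<^sup>2 - 2) B"
      using gen by (simp add: generating_def)
    then have Brel: "B \<subseteq> rel 1 (tl r)" by (auto simp: torsion_family_def)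
    have relT: "rel 1 (tl r) \<subseteq> ?T"
      using rel_frags[OF _ tlr] phi_rel[OF _ r] S(2) by (auto simp: numeral_2_eq_2)
    have "C \<subseteq> ?T" using gen S(3) by (auto simp: generating_def torsion_family_def)
    moreover have "add_closed ?T" by (rule add_closed_vimage_phi[OF S(1)])
    moreover have "frags (V 1) \<subseteq> U"
      if "add_closed U" "rel 1 (tl r) \<subseteq> U" "C \<subseteq> U" "B \<subseteq> U" for U
      using gen that by (simp add: generating_def)
    ultimately have "frags (V 1) \<subseteq> ?T" using relT Brel by (meson order_trans)
    moreover have "frag_of v \<in> frags (V 1)" if "v \<in> V 1" for v using that by simp
    ultimately have phiS: "phi (frag_of v) \<in> S" if "v \<in> V 1" for v using that by blast
    fix v assume v: "v \<in> V 2"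
    have free: "frag_of u \<in> S" if u: "u \<in> insert r (free_arcs 1 r)" for u
    proof (cases "u = r")
      case True
      then show ?thesis using root_in_rel S(2) by blast
    next
      case False
      then have "frag_of u + phi (frag_of (tl u)) \<in> S" using S(4) u by blast
      moreover have "phi (frag_of (tl u)) \<in> S"
        using phiS V_tl[of u 1] u False by (auto simp: free_arcs_def)
      ultimately show ?thesis using S(1) by (metis add_closed_diff add_diff_cancel_right')
    qed
    show "frag_of v \<in> S"
    proof (cases "v \<in> insert r (free_arcs 1 r)")
      case False
      then obtain w where w: "w \<in> V 1" "v = w @ [spare (last w) (last r)]"
        using v by (auto simp: free_arcs_def numeral_2_eq_2)
      let ?q = "spare (last w) (last r)"
      \<comment> \<open>\<open>v\<close> is the omitted arc at \<open>w\<close>; it is recovered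
        from \<open>phi\<close> of \<open>w\<close>, the sum of all arcs leaving
        \<open>w\<close>.\<close>
      have "phi (frag_of w) = frag_of v + (\<Sum>c\<in>{0..m} - {last w} - {?q}. frag_of (w @ [c]))"
        unfolding phi_def frag_extend_of w(2) using spare by (intro sum.remove) auto
      moreover have "frag_of (w @ [c]) \<in> S" if c: "c \<in> {0..m} - {last w} - {?q}" for c
      proof -
        have "w @ [c] \<in> V (Suc 1)" using w c by (auto simp: V_snoc)
        moreover have "w @ [c] \<notin> (\<lambda>w. w @ [spare (last w) (last r)]) ` V 1" using c by auto
        ultimately show ?thesis by (intro free) (auto simp: free_arcs_def)
      qed
      then have "(\<Sum>c\<in>{0..m} - {last w} - {?q}. frag_of (w @ [c])) \<in> S"
        using S(1) by (intro add_closed_sum) auto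
      ultimately show ?thesis
        using phiS[OF w(1)] S(1) by (metis add_closed_diff add_diff_cancel_right')
    qed (use free in auto)
  qed
  ultimately show ?thesis by (auto simp: generating_def)
qed

text \<open>For each middle part \<open>y\<close> there are \<open>m - 1\<close> choices of
  \<open>a\<close>, as \<open>a = pre y\<close> would give the zero difference, and
  \<open>m - 1\<close> choices of \<open>c\<close>, as one last letter is redundant: the sum over
  all admissible \<open>c\<close> is a value of \<open>phi\<close>.\<close>

definition new_index :: "nat \<Rightarrow> (nat \<times> nat list \<times> nat) set" where
  "new_index n = (SIGMA a:{0..m}. SIGMA y:{y \<in> V n. a \<noteq> hd y \<and> a \<noteq> pre y}.
      {0..m} - {last y, spare (last y) (last y)})"

definition new_elem :: "nat \<times> nat list \<times> nat \<Rightarrow> nat list \<Rightarrow>\<^sub>0 int" where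
  "new_elem = (\<lambda>(a, y, c). frag_of (a # y @ [c]) - frag_of (pre y # y @ [c]))"

lemma finite_new_index [simp]: "finite (new_index n)"
  by (simp add: new_index_def)

lemma card_new_index:
  assumes "n \<ge> 1"
  shows "card (new_index n) = card (V n) * (m - 1)\<^sup>2"
proof -
  have c: "card ({0..m} - {a, spare a a}) = m - 1" if "a \<le> m" for a
    using that spare[of a a] by (subst card_Diff_subset) auto
  have "new_index n = (\<lambda>(y, a, c). (a, y, c)) `
      (SIGMA y:V n. ({0..m} - {hd y, pre y}) \<times> ({0..m} - {last y, spare (last y) (last y)}))"
    by (force simp: new_index_def)
  then have "card (new_index n) =
      card (SIGMA y:V n. ({0..m} - {hd y, pre y}) \<times> ({0..m} - {last y, spare (last y) (last y)}))"
    by (simp add: card_image inj_on_def split_beta prod_eq_iff)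
  also have "\<dots> = (\<Sum>y\<in>V n. (m - 1) * (m - 1))"
    using assms c V_hd_le V_last_le
    by (subst card_SigmaI) (auto simp: card_cartesian_product pre_def intro!: sum.cong)
  finally show ?thesis by (simp add: power2_eq_square)
qed

text \<open>The two strings have the same tail, so \<open>psi\<close> kills their difference, and
  \<open>m\<close> times an element is \<open>phi\<close> of its image under \<open>psi\<close>
  modulo relations.\<close>

lemma new_elem_torsion:
  assumes n: "n \<ge> 1" and i: "i \<in> new_index n"
  shows "new_elem i \<in> frags (V (Suc (Suc n)))" "frag_cmul (int m) (new_elem i) \<in> rel (Suc (Suc n)) r"
proof -
  obtain a y c where ayc: "i = (a, y, c)" by (metis surj_pair)
  have y: "y \<in> V n" "y \<noteq> []" using i V_nonempty n by (auto simp: new_index_def ayc)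
  then have "a # y @ [c] \<in> V (Suc (Suc n))" "pre y # y @ [c] \<in> V (Suc (Suc n))"
    using i pre by (auto simp: new_index_def ayc V_Cons V_snoc)
  then show e: "new_elem i \<in> frags (V (Suc (Suc n)))"
    by (auto simp: new_elem_def ayc add_closed_frags intro!: add_closed_diff)
  have "psi (new_elem i) = 0" by (simp add: new_elem_def ayc psi_linear) (simp add: psi_def)
  then show "frag_cmul (int m) (new_elem i) \<in> rel (Suc (Suc n)) r"
    using phi_psi_minus_cmul_rel[OF _ e, of r] add_closed_minus[OF add_closed_rel]
    by (fastforce simp: phi_linear)
qed

lemma torsion_family_new:
  assumes "n \<ge> 1"
  shows "torsion_family (Suc (Suc n)) r m (block_size (Suc (Suc n)) 1) (new_elem ` new_index n)"
proof -
  have "card (V n) * (m - 1)\<^sup>2 = block_size (Suc (Suc n)) 1"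
    using assms card_V[of "n - 1"] by (simp add: block_size_def algebra_simps)
  then show ?thesis
    using new_elem_torsion[OF assms] card_image_le[OF finite_new_index, of new_elem n]
      card_new_index[OF assms]
    by (auto simp: torsion_family_def)
qed

text \<open>For a last letter allowed in \<open>new_index\<close> this is a new element; for the
  omitted one it is a value of \<open>phi\<close> minus the other differences. Consequently first
  letters may be exchanged modulo \<open>S\<close>.\<close>

lemma first_letter_diff:
  assumes n: "n \<ge> 1" and S: "add_closed S" "\<And>x. x \<in> frags (V (Suc n)) \<Longrightarrow> phi x \<in> S"
      "new_elem ` new_index n \<subseteq> S"
    and w: "w \<in> V (Suc n)" and a: "a # w \<in> V (Suc (Suc n))"
  shows "frag_of (a # w) - frag_of (pre w # w) \<in> S"
proof (cases "a = pre w")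
  case True
  then show ?thesis using S(1) by (simp add: add_closed_zero)
next
  case False
  define y c where "y = butlast w" "c = last w"
  have y: "y \<in> V n" "y \<noteq> []" "w = y @ [c]" "c \<le> m" "c \<noteq> last y"
    using w V_butlast[OF w] V_nonempty[of y n] V_nonempty[OF w] n V_snoc[of y c n]
    by (auto simp: y_c_def)
  have av: "a \<le> m" "a \<noteq> hd y" "a \<noteq> pre y" "pre w = pre y"
    using a y False by (auto simp: V_Cons pre_snoc)
  let ?q = "spare (last y) (last y)"
  let ?d = "\<lambda>c. frag_of (a # y @ [c]) - frag_of (pre y # y @ [c])"
  have free: "?d c \<in> S" if "c \<in> {0..m} - {last y} - {?q}" for c
  proof -
    have "(a, y, c) \<in> new_index n" using that y av by (auto simp: new_index_def)
    then show ?thesis using S(3) by (force simp: new_elem_def)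
  qed
  show ?thesis
  proof (cases "c = ?q")
    case False
    then show ?thesis using free[of c] y av by auto
  next
    case True
    have ext: "a # y \<in> V (Suc n)" "pre y # y \<in> V (Suc n)"
      using y av pre by (auto simp: V_Cons)
    have "phi (frag_of (a # y) - frag_of (pre y # y)) = (\<Sum>c\<in>{0..m} - {last y}. ?d c)"
      using y(2) by (simp add: phi_linear) (simp add: phi_def sum_subtractf)
    also have "\<dots> = ?d c + (\<Sum>c\<in>{0..m} - {last y} - {?q}. ?d c)"
      unfolding True using spare by (intro sum.remove) auto
    finally have "?d c = phi (frag_of (a # y) - frag_of (pre y # y)) - (\<Sum>c\<in>{0..m} - {last y} - {?q}. ?d c)"
      by (simp add: algebra_simps)
    moreover have "phi (frag_of (a # y) - frag_of (pre y # y)) \<in> S"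
      using ext by (intro S(2) add_closed_diff add_closed_frags) auto
    moreover have "(\<Sum>c\<in>{0..m} - {last y} - {?q}. ?d c) \<in> S"
      using free S(1) by (intro add_closed_sum) auto
    ultimately show ?thesis using y av S(1) by (simp add: add_closed_diff)
  qed
qed

text \<open>For a subgroup \<open>S\<close> containing the relations and the new generators,
  \<open>span\<close> is used twice: to place all values of \<open>phi\<close> in \<open>S\<close>,
  and then all values of \<open>lift\<close>. In between, \<open>first_letter_diff\<close> shows
  that modulo \<open>S\<close> each string equals the lift of its tail.\<close>

lemma generating_step:
  assumes n: "n \<ge> 1" and r: "r \<in> V (Suc (Suc n))" and gen: "generating (Suc n) (tl r) C B A"
  shows "generating (Suc (Suc n)) r (phi ` C) (lift ` B)
    (\<lambda>i. if i = 1 then new_elem ` new_index n else lift ` A (i - 1))"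
    (is "generating ?n r ?C ?B ?A")
proof -
  have famC: "torsion_family (Suc n) (tl r) (m + 1) (m - 1) C"
    and famB: "torsion_family (Suc n) (tl r) (m ^ n) (m\<^sup>2 - 2) B"
    and famA: "\<And>i. i \<in> {1..n - 1} \<Longrightarrow> torsion_family (Suc n) (tl r) (m ^ i) (block_size (Suc n) i) (A i)"
    and span: "\<And>S. add_closed S \<Longrightarrow> rel (Suc n) (tl r) \<subseteq> S \<Longrightarrow> C \<subseteq> S \<Longrightarrow> B \<subseteq> S \<Longrightarrow>
      (\<And>i. i \<in> {1..n - 1} \<Longrightarrow> A i \<subseteq> S) \<Longrightarrow> frags (V (Suc n)) \<subseteq> S"
    using gen by (auto simp: generating_def numeral_2_eq_2)
  have torC: "torsion_family ?n r (m + 1) (m - 1) ?C"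
    using torsion_family_phi[OF _ r famC] by simp
  have torB: "torsion_family ?n r (m ^ Suc n) (m\<^sup>2 - 2) ?B"
    using torsion_family_lift[OF _ r famB] by simp
  have torA: "torsion_family ?n r (m ^ i) (block_size ?n i) (?A i)" if i: "i \<in> {1..n}" for i
  proof (cases "i = 1")
    case True
    then show ?thesis using torsion_family_new[OF n] by simp
  next
    case False
    then have "i - 1 \<in> {1..n - 1}" using i by auto
    from torsion_family_lift[OF _ r famA[OF this]] have
      "torsion_family ?n r (m * m ^ (i - 1)) (block_size (Suc n) (i - 1)) (?A i)" using False by simp
    moreover have "m * m ^ (i - 1) = m ^ i" using i by (cases i) auto
    \<comment> \<open>\<open>block_size\<close> depends only on the difference of its arguments, so
      raising both the length and \<open>i\<close> by one keeps it.\<close>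
    moreover have "block_size (Suc n) (i - 1) = block_size ?n i"
      using i False by (simp add: block_size_def)
    ultimately show ?thesis by simp
  qed
  have sp: "frags (V ?n) \<subseteq> S"
    if S: "add_closed S" "rel ?n r \<subseteq> S" "?C \<subseteq> S" "?B \<subseteq> S" "\<And>i. i \<in> {1..n} \<Longrightarrow> ?A i \<subseteq> S" for S
  proof -
    have tlr: "tl r \<in> V (Suc n)" by (rule V_tl[OF r])
    have liftA: "lift ` A i \<subseteq> S" if "i \<in> {1..n - 1}" for i
    proof -
      have "Suc i \<in> {1..n}" using that by auto
      from S(5)[OF this] show ?thesis using that by auto
    qed
    have new: "new_elem ` new_index n \<subseteq> S" using S(5)[of 1] n by auto
    have phi_iff: "phi x \<in> S \<longleftrightarrow> frag_cmul (int m) (lift x) \<in> S" if "x \<in> frags (V (Suc n))" for x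
      using lift_rel[OF _ that, of r] S(2) by (intro add_closed_cong[OF S(1)]) auto
    have phi_of_lift: "phi x \<in> S" if "x \<in> frags (V (Suc n))" "lift x \<in> S" for x
      using phi_iff[OF that(1)] add_closed_cmul[OF S(1) that(2)] by blast
    have "frags (V (Suc n)) \<subseteq> {x \<in> frags (V (Suc n)). phi x \<in> S}"
    proof (rule span[OF add_closed_vimage_phi[OF S(1)]])
      show "rel (Suc n) (tl r) \<subseteq> {x \<in> frags (V (Suc n)). phi x \<in> S}"
        using rel_frags[OF _ tlr] phi_rel[OF _ r] S(2) by auto
      show "C \<subseteq> {x \<in> frags (V (Suc n)). phi x \<in> S}"
        using famC S(3) by (auto simp: torsion_family_def)
      show "B \<subseteq> {x \<in> frags (V (Suc n)). phi x \<in> S}"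
        using famB S(4) phi_of_lift by (auto simp: torsion_family_def)
      show "A i \<subseteq> {x \<in> frags (V (Suc n)). phi x \<in> S}" if "i \<in> {1..n - 1}" for i
        using famA[OF that] liftA[OF that] phi_of_lift by (auto simp: torsion_family_def)
    qed
    then have phiS: "phi x \<in> S" if "x \<in> frags (V (Suc n))" for x using that by blast
    have mS: "frag_cmul (int m) x \<in> S" if "x \<in> frags (V ?n)" for x
      using cmul_mem[OF _ S(2,1) phiS that] by simp
    have diff: "frag_of (a # w) - frag_of (pre w # w) \<in> S"
      if "w \<in> V (Suc n)" "a # w \<in> V ?n" for a w
      using first_letter_diff[OF n S(1) phiS new that] .
    \<comment> \<open>For a single string \<open>w\<close>, the terms of \<open>phi\<close> and of
      \<open>lift (shift _)\<close> have the same tails and differ only in first letters, so the two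
      agree modulo \<open>S\<close>. This is what lets \<open>lift\<close> carry relations into
      \<open>S\<close>.\<close>
    have shiftS: "lift (shift x) \<in> S" if x: "x \<in> frags (V (Suc n))" for x
    proof -
      have one: "lift (shift (frag_of w)) \<in> S" if w: "w \<in> V (Suc n)" for w
      proof -
        obtain b v where v: "w = b # v" using V_nonempty[OF w] by (cases w) auto
        have vn: "v \<in> V n" "v \<noteq> []" using w V_nonempty[of v n] n by (auto simp: V_Cons v)
        have "phi (frag_of w) - lift (shift (frag_of w)) =
            (\<Sum>c\<in>{0..m} - {last w}. frag_of (w @ [c]) - frag_of (pre (v @ [c]) # v @ [c]))"
          by (simp add: phi_def shift_def lift_def frag_extend_finite_sum sum_subtractf v)
        moreover have "frag_of (w @ [c]) - frag_of (pre (v @ [c]) # v @ [c]) \<in> S"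
          if "c \<in> {0..m} - {last w}" for c
          using diff[of "v @ [c]" b] that w vn by (auto simp: v V_Cons V_snoc)
        ultimately have "phi (frag_of w) - lift (shift (frag_of w)) \<in> S"
          using S(1) by (metis (no_types, lifting) add_closed_sum)
        then show ?thesis using phiS[of "frag_of w"] w add_closed_cong[OF S(1)] by auto
      qed
      have "frag_extend (\<lambda>w. lift (shift (frag_of w))) x \<in> S"
        using x by (intro frag_extend_closed[OF _ S(1)] one) (auto simp: frags_def)
      then show ?thesis
        by (simp add: lift_def shift_def frag_extend_frag_extend)
    qed
    \<comment> \<open>Second use of \<open>span\<close>, now for the preimage of \<open>S\<close>
      under \<open>lift\<close>.\<close>
    have "frags (V (Suc n)) \<subseteq> {x \<in> frags (V (Suc n)). lift x \<in> S}" (is "_ \<subseteq> ?T")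
    proof (rule span[OF add_closed_vimage_lift[OF S(1)]])
      show relT: "rel (Suc n) (tl r) \<subseteq> ?T"
      proof
        fix z assume z: "z \<in> rel (Suc n) (tl r)"
        then obtain y t where y: "z = lapl y + frag_cmul t (frag_of (tl r))" "y \<in> frags (V (Suc n))"
          unfolding rel_def by blast
        have "lift (lapl y) \<in> S"
          unfolding lapl_def lift_linear
          by (intro add_closed_diff S(1) shiftS y mS lift_frags)
        moreover have "lift (frag_of (tl r)) \<in> S"
        proof -
          have "hd r # tl r = r" using V_nonempty[OF r] by simp
          then have "frag_of r - lift (frag_of (tl r)) \<in> S"
            using diff[OF tlr, of "hd r"] r by (simp add: lift_def)
          moreover have "frag_of r \<in> S" using root_in_rel S(2) by blast
          ultimately show ?thesis using add_closed_cong[OF S(1)] by blast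
        qed
        ultimately have "lift z \<in> S"
          using S(1) by (simp add: y(1) lift_linear add_closed_add add_closed_cmul)
        then show "z \<in> ?T" using rel_frags[OF _ tlr] z by auto
      qed
      show "C \<subseteq> ?T"
      proof
        fix x assume "x \<in> C"
        then have x: "x \<in> frags (V (Suc n))" "frag_cmul (int (m + 1)) x \<in> rel (Suc n) (tl r)"
          using famC by (auto simp: torsion_family_def)
        have "lift (frag_cmul (int (m + 1)) x) \<in> S" using relT x(2) by blast
        \<comment> \<open>\<open>m\<close> and \<open>m + 1\<close> are coprime: \<open>S\<close>
          contains both multiples of \<open>lift x\<close>, hence \<open>lift x\<close>.\<close>
        then have "frag_cmul (int m) (lift x) + lift x \<in> S"
          by (simp add: lift_linear frag_cmul_distrib add.commute)
        then show "x \<in> ?T"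
          using x mS[OF lift_frags[OF x(1)]] S(1) by (metis (no_types, lifting) CollectI
            add_closed_diff add_diff_cancel_left')
      qed
      show "B \<subseteq> ?T" using famB S(4) by (auto simp: torsion_family_def)
      show "A i \<subseteq> ?T" if "i \<in> {1..n - 1}" for i
        using famA[OF that] liftA[OF that] by (auto simp: torsion_family_def)
    qed
    moreover have "frag_of w \<in> frags (V (Suc n))" if "w \<in> V (Suc n)" for w
      using that by simp
    ultimately have liftS: "lift (frag_of w) \<in> S" if "w \<in> V (Suc n)" for w
      using that by blast
    show ?thesis
    proof (rule frags_subset[OF S(1)])
      fix v assume v: "v \<in> V ?n"
      have "hd v # tl v = v" using V_nonempty[OF v] by simp
      then have "frag_of v - lift (frag_of (tl v)) \<in> S"
        using diff[OF V_tl[OF v], of "hd v"] v by (simp add: lift_def)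
      then show "frag_of v \<in> S" using liftS[OF V_tl[OF v]] add_closed_cong[OF S(1)] by blast
    qed
  qed
  have idx: "Suc (Suc n) - 1 = Suc n" "Suc (Suc n) - 2 = n" by auto
  show ?thesis
    unfolding generating_def idx
  proof (intro conjI ballI allI impI torC torB)
    fix i assume "i \<in> {1..n}"
    then show "torsion_family ?n r (m ^ i) (block_size ?n i) (?A i)" by (rule torA)
  next
    fix S assume "add_closed S" "rel ?n r \<subseteq> S" "?C \<subseteq> S" "?B \<subseteq> S"
      and "\<forall>i\<in>{1..n}. ?A i \<subseteq> S"
    then show "frags (V ?n) \<subseteq> S" by (intro sp) simp_all
  qed
qed

lemma generating_exists:
  assumes "r \<in> V (Suc n)"
  shows "\<exists>C B A. generating (Suc n) r C B A"
  using assms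
proof (induction n arbitrary: r)
  case 0
  then have "\<exists>C B A. generating 1 r C B A" using generating_1[of r] by (simp only: One_nat_def) blast
  then show ?case by simp
next
  case (Suc n)
  obtain C B A where gen: "generating (Suc n) (tl r) C B A"
    using Suc.IH[OF V_tl[OF Suc.prems]] by blast
  show ?case
  proof (cases n)
    case 0
    have "r \<in> V (Suc 1)" using Suc.prems 0 by simp
    moreover have "generating 1 (tl r) C B A" using gen 0 by simp
    ultimately have "\<exists>C B A. generating 2 r C B A" by (blast intro: generating_2)
    then show ?thesis using 0 by (simp add: numeral_2_eq_2)
  next
    case (Suc k)
    then have "n \<ge> 1" by simp
    from generating_step[OF this Suc.prems gen] show ?thesis by blast
  qed
qed

subsection \<open>The isomorphism\<close>

text \<open>The graph is Eulerian: the shifts of all vertices add up to the heads of all arcs, and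
  grouping the arcs by head shows that each vertex occurs \<open>m\<close> times.\<close>

lemma sum_lapl_zero:
  assumes "n \<ge> 1"
  shows "(\<Sum>v\<in>V n. lapl (frag_of v)) = 0"
proof -
  have "(\<Sum>v\<in>V n. shift (frag_of v)) = (\<Sum>u\<in>V (Suc n). frag_of (tl u))"
    unfolding sum_snoc[OF assms] using V_nonempty assms
    by (intro sum.cong) (auto simp: shift_def)
  also have "\<dots> = (\<Sum>v\<in>V n. frag_cmul (int m) (frag_of v))"
    unfolding sum_Cons[OF assms]
  proof (intro sum.cong refl)
    fix v assume "v \<in> V n"
    then have "card ({0..m} - {hd v}) = m" using V_hd_le assms by simp
    then show "(\<Sum>a\<in>{0..m} - {hd v}. frag_of (tl (a # v))) = frag_cmul (int m) (frag_of v)"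
      using sum_const_frag[of "{0..m} - {hd v}" "frag_of v"] by simp
  qed
  finally show ?thesis by (simp add: lapl_def sum_subtractf)
qed

lemma out_arcs_kautz:
  assumes "n \<ge> 1" "v \<in> V n"
  shows "out_arcs (kautz_graph n m) v = (\<lambda>c. v @ [c]) ` ({0..m} - {last v})"
proof -
  have "u \<in> (\<lambda>c. v @ [c]) ` ({0..m} - {last v})" if "u \<in> V (Suc n)" "v = butlast u" for u
  proof -
    have u: "u = v @ [last u]" using V_nonempty[OF that(1)] that(2) by simp
    then have "last u \<in> {0..m} - {last v}"
      using that(1) V_nonempty[OF assms(2,1)] V_snoc[of v "last u" n] by auto
    then show ?thesis using u by blast
  qed
  then show ?thesis
    using assms by (auto simp: out_arcs_def kautz_graph_def V_snoc)
qed

lemma laplacian_at_kautz: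
  assumes "n \<ge> 1" "v \<in> V n"
  shows "laplacian_at (kautz_graph n m) v = lapl (frag_of v)"
proof -
  have v: "v \<noteq> []" "last v \<le> m" using assms V_nonempty V_last_le by auto
  have "(\<Sum>c\<in>{0..m} - {last v}. frag_of v) = frag_cmul (int m) (frag_of v)"
  proof -
    have "card ({0..m} - {last v}) = m" using v by simp
    then show ?thesis using sum_const_frag[of "{0..m} - {last v}" "frag_of v"] by simp
  qed
  then show ?thesis
    using v unfolding laplacian_at_def out_arcs_kautz[OF assms]
    by (subst sum.reindex)
      (auto simp: inj_on_def kautz_graph_def lapl_def shift_def sum_subtractf)
qed

text \<open>The generators in \<open>critical_group\<close> leave out the Laplacian at the root,
  which by \<open>sum_lapl_zero\<close> is minus the sum of the others.\<close>

lemma generate_eq_rel: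
  assumes n: "n \<ge> 1" and r: "r \<in> V n"
  shows "generate (free_Abelian_group (V n))
    (insert (frag_of r) (laplacian_at (kautz_graph n m) ` (V n - {r}))) = rel n r"
    (is "generate ?F ?G = _")
proof
  interpret F: group ?F by simp
  have G: "?G \<subseteq> rel n r"
    using n r by (auto simp: laplacian_at_kautz root_in_rel intro!: lapl_in_rel)
  have "subgroup (rel n r) ?F"
    using add_closed_rel rel_frags[OF n r] by (simp add: subgroup_free_Abelian_group_iff)
  then show "generate ?F ?G \<subseteq> rel n r" using F.generate_subgroup_incl[OF G] by blast
  have "?G \<subseteq> carrier ?F"
    using G rel_frags[OF n r] unfolding carrier_free_Abelian_group by (rule order_trans)
  then have "subgroup (generate ?F ?G) ?F" by (rule F.generate_is_subgroup)
  then have closed: "add_closed (generate ?F ?G)"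
    by (simp add: subgroup_free_Abelian_group_iff)
  have inc: "g \<in> generate ?F ?G" if "g \<in> ?G" for g using that by (rule generate.incl)
  have other: "lapl (frag_of v) \<in> generate ?F ?G" if "v \<in> V n - {r}" for v
    using inc[of "lapl (frag_of v)"] that laplacian_at_kautz[OF n, of v] by force
  have "lapl (frag_of r) = - (\<Sum>v\<in>V n - {r}. lapl (frag_of v))"
    using sum_lapl_zero[OF n] sum.remove[OF finite_V r, of "\<lambda>v. lapl (frag_of v)"]
    by (simp add: eq_neg_iff_add_eq_0)
  moreover have "(\<Sum>v\<in>V n - {r}. lapl (frag_of v)) \<in> generate ?F ?G"
    by (intro add_closed_sum closed other)
  ultimately have "lapl (frag_of r) \<in> generate ?F ?G"
    using add_closed_minus[OF closed] by simp
  then have all: "lapl (frag_of v) \<in> generate ?F ?G" if "v \<in> V n" for v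
    using that other by (cases "v = r") auto
  have lap: "lapl y \<in> generate ?F ?G" if y: "y \<in> frags (V n)" for y
  proof -
    have "Poly_Mapping.keys y \<subseteq> V n" using y by (simp add: frags_def)
    then show ?thesis
      by (induction y rule: frag_induction)
        (auto simp: lapl_linear all closed add_closed_zero add_closed_diff)
  qed
  have "frag_of r \<in> generate ?F ?G" by (rule inc) simp
  then show "rel n r \<subseteq> generate ?F ?G"
    unfolding rel_def using closed lap by (auto intro!: add_closed_add add_closed_cmul)
qed

lemma critical_group_eq:
  assumes "n \<ge> 1" "r \<in> V n"
  shows "critical_group (kautz_graph n m) r = free_Abelian_group (V n) Mod rel n r"
  using generate_eq_rel[OF assms] by (simp add: critical_group_def kautz_graph_def)

section \<open>Comparison of the exponents of \<open>m\<close>\<close>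

lemma sum_block_sizes:
  "(\<Sum>i = 1..k. i * block_size (k + 2) i) + (m\<^sup>2 - 1) * (k + 1) + m + 1 = (m + 1) * m ^ (k + 1)"
proof -
  obtain a where a: "m = Suc a" using m_ge by (cases m) auto
  \<comment> \<open>With \<open>a = m - 1\<close>, multiplying the weighted sum by \<open>a\<close>
    leaves a geometric sum minus \<open>k + 1\<close>; a second factor \<open>a\<close> in
    \<open>U\<close> makes it closed. \<open>block_size\<close> supplies both factors.\<close>
  have "a * (\<Sum>i = 1..k. i * m ^ (k - i)) + (k + 1) = (\<Sum>i\<le>k. m ^ i)"
  proof (induction k)
    case (Suc k)
    have "(\<Sum>i = 1..k. i * m ^ (Suc k - i)) = m * (\<Sum>i = 1..k. i * m ^ (k - i))"
      unfolding sum_distrib_left by (rule sum.cong) (auto simp: Suc_diff_le)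
    then have "a * (\<Sum>i = 1..Suc k. i * m ^ (Suc k - i)) + (Suc k + 1)
        = m * (a * (\<Sum>i = 1..k. i * m ^ (k - i)) + (k + 1)) + 1"
      by (simp add: a algebra_simps)
    also have "\<dots> = (\<Sum>i\<le>Suc k. m ^ i)"
      unfolding Suc.IH by (simp only: sum.atMost_Suc_shift sum_distrib_left power_Suc power_0)
    finally show ?case .
  qed simp
  note geo = this
  have U: "a * (a * (\<Sum>i = 1..k. i * m ^ (k - i))) + a * (k + 1) + 1 = m ^ (k + 1)"
  proof -
    have "a * (\<Sum>i\<le>k. m ^ i) + 1 = m ^ (k + 1)"
      by (induction k) (auto simp: a algebra_simps)
    then show ?thesis unfolding geo[symmetric] by (simp add: algebra_simps)
  qed
  have "(\<Sum>i = 1..k. i * block_size (k + 2) i) = (m + 1) * (a * (a * (\<Sum>i = 1..k. i * m ^ (k - i))))"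
    unfolding sum_distrib_left block_size_def
    by (rule sum.cong) (auto simp: a power2_eq_square algebra_simps)
  moreover have "m\<^sup>2 - 1 = (m + 1) * a" by (simp add: a power2_eq_square)
  ultimately have "(\<Sum>i = 1..k. i * block_size (k + 2) i) + (m\<^sup>2 - 1) * (k + 1) + m + 1
      = (m + 1) * (a * (a * (\<Sum>i = 1..k. i * m ^ (k - i))) + a * (k + 1) + 1)"
    by (simp add: algebra_simps)
  then show ?thesis unfolding U .
qed

text \<open>Apart from \<open>m + n\<close>, the left side is the exponent of \<open>m\<close> in
  \<open>card_target\<close>; the identity matches it with the exponent in
  \<open>separated_exists\<close>.\<close>

lemma exponent_total:
  assumes "n \<ge> 1"
  shows "(n - 1) * (m\<^sup>2 - 2) + (\<Sum>i\<in>{1..n - 2}. i * block_size n i) + m + n = (m + 1) * m ^ (n - 1)"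
proof (cases "n = 1")
  case False
  define k where "k = n - 2"
  have n: "n = k + 2" using assms False by (simp add: k_def)
  have "m\<^sup>2 \<ge> 4" using m_ge power_mono[of 2 m 2] by simp
  then obtain q where "m\<^sup>2 = q + 2" using le_Suc_ex[of 2 "m\<^sup>2"] by auto
  then have "(m\<^sup>2 - 1) * (k + 1) = (m\<^sup>2 - 2) * (k + 1) + (k + 1)" by simp
  then show ?thesis using sum_block_sizes[of k] by (simp add: n algebra_simps)
qed simp

definition target :: "nat \<Rightarrow> ((nat \<Rightarrow> int) \<times> (nat \<Rightarrow> int) \<times> (nat \<Rightarrow> nat \<Rightarrow> int)) monoid" where
  "target n = cyclic_power (m + 1) (m - 1) \<times>\<times> cyclic_power (m ^ (n - 1)) (m\<^sup>2 - 2) \<times>\<times>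
    sum_group {1..n - 2} (\<lambda>i. cyclic_power (m ^ i) (block_size n i))"

lemma group_target: "group (target n)"
  by (simp add: target_def DirProd_group)

lemma carrier_target:
  "carrier (target n) = carrier (cyclic_power (m + 1) (m - 1)) \<times>
    carrier (cyclic_power (m ^ (n - 1)) (m\<^sup>2 - 2)) \<times>
    (\<Pi>\<^sub>E i\<in>{1..n - 2}. carrier (cyclic_power (m ^ i) (block_size n i)))"
  by (simp add: target_def carrier_sum_group_finite)

lemma finite_target: "finite (carrier (target n))"
  using m_ge by (auto simp: carrier_target intro!: finite_cartesian_product finite_PiE finite_card_cyclic_power)

lemma card_target:
  "card (carrier (target n)) =
    (m + 1) ^ (m - 1) * m ^ ((n - 1) * (m\<^sup>2 - 2) + (\<Sum>i\<in>{1..n - 2}. i * block_size n i))"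
proof -
  have "card (\<Pi>\<^sub>E i\<in>{1..n - 2}. carrier (cyclic_power (m ^ i) (block_size n i)))
      = (\<Prod>i\<in>{1..n - 2}. m ^ (i * block_size n i))"
    using m_ge by (simp add: card_PiE finite_card_cyclic_power power_mult)
  also have "\<dots> = m ^ (\<Sum>i\<in>{1..n - 2}. i * block_size n i)"
    by (simp add: power_sum)
  finally show ?thesis
    using m_ge by (simp add: carrier_target card_cartesian_product finite_card_cyclic_power
        power_add power_mult)
qed

lemma critical_group_iso_target:
  assumes n: "n \<ge> 1" and r: "r \<in> V n"
  shows "critical_group (kautz_graph n m) r \<cong> target n"
proof -
  let ?F = "free_Abelian_group (V n)"
  let ?K = "?F Mod rel n r"
  let ?c = "\<lambda>x. rel n r #>\<^bsub>?F\<^esub> x"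
  interpret F: comm_group ?F by (rule abelian_free_Abelian_group)
  have sub: "subgroup (rel n r) ?F"
    using add_closed_rel rel_frags[OF n r] by (simp add: subgroup_free_Abelian_group_iff)
  then have norm: "rel n r \<lhd> ?F" by (rule F.subgroup_imp_normal)
  interpret N: normal "rel n r" ?F by (rule norm)
  interpret K: comm_group ?K by (rule F.abelian_FactGroup[OF sub])
  note carF = carrier_free_Abelian_group[of "V n"]
  have c_hom: "?c \<in> hom ?F ?K" by (rule N.r_coset_hom_Mod)
  interpret c: group_hom ?F ?K ?c using c_hom by unfold_locales
  have carK: "carrier ?K = ?c ` frags (V n)"
    unfolding carF[symmetric] by (auto simp: FactGroup_def RCOSETS_def)
  have c_eq: "?c x = ?c y \<longleftrightarrow> x - y \<in> rel n r" for x y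
    by (rule r_coset_free_Abelian_group_eq_iff[OF add_closed_rel])
  have tors: "(?c x) [^]\<^bsub>?K\<^esub> d = \<one>\<^bsub>?K\<^esub>"
    if "x \<in> frags (V n)" "frag_cmul (int d) x \<in> rel n r" for x and d :: nat
  proof -
    have "(?c x) [^]\<^bsub>?K\<^esub> d = ?c (frag_cmul (int d) x)"
      using c.hom_nat_pow[of x d] that carF by simp
    also have "\<dots> = ?c 0"
      using that by (subst c_eq) simp
    also have "\<dots> = \<one>\<^bsub>?K\<^esub>" using c.hom_one by simp
    finally show ?thesis .
  qed
  have cov: "covers (cyclic_power d a) ?K (?c ` B)" if "d > 0" "torsion_family n r d a B" for d a B
  proof (rule K.covers_cyclic_power)
    show "?c ` B \<subseteq> carrier ?K" "finite (?c ` B)"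
      using that(2) carK by (auto simp: torsion_family_def)
    show "card (?c ` B) \<le> a"
      using that(2) card_image_le[of B ?c] by (auto simp: torsion_family_def)
    show "x [^]\<^bsub>?K\<^esub> d = \<one>\<^bsub>?K\<^esub>" if "x \<in> ?c ` B" for x
      using that \<open>torsion_family n r d a B\<close> tors by (auto simp: torsion_family_def)
  qed fact
  obtain k where k: "n = Suc k" using n by (cases n) auto
  obtain C B A where gen: "generating n r C B A" using generating_exists r k by blast
  let ?gens = "?c ` C \<union> (?c ` B \<union> (\<Union>i\<in>{1..n - 2}. ?c ` A i))"
  have "covers (target n) ?K ?gens"
    unfolding target_def
    by (intro K.covers_DirProd K.covers_sum_group cov DirProd_group sum_group group_cyclic_power)
      (use gen m_ge in \<open>auto simp: generating_def\<close>)
  then have "?K \<cong> target n"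
  proof (rule iso_of_covers[OF group_target finite_target K.is_group])
    fix S assume S: "subgroup S ?K" "?gens \<subseteq> S"
    interpret S: subgroup S ?K by (rule S)
    \<comment> \<open>Pulled back to the free group, \<open>S\<close> becomes an additive subgroup
      to which the last clause of \<open>generating\<close> applies.\<close>
    let ?T = "{x \<in> frags (V n). ?c x \<in> S}"
    have "add_closed ?T"
      unfolding add_closed_def
    proof (intro conjI ballI)
      show "0 \<in> ?T"
        using c.hom_one S.one_closed by (simp add: add_closed_zero add_closed_frags)
      fix x y assume xy: "x \<in> ?T" "y \<in> ?T"
      then have xy': "x \<in> carrier ?F" "y \<in> carrier ?F" unfolding carF by auto
      have "x - y = x \<otimes>\<^bsub>?F\<^esub> inv\<^bsub>?F\<^esub> y" using xy' by simp
      then have "?c (x - y) = ?c x \<otimes>\<^bsub>?K\<^esub> inv\<^bsub>?K\<^esub> ?c y"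
        using c.hom_mult[OF xy'(1) F.inv_closed[OF xy'(2)]] c.hom_inv[OF xy'(2)] by metis
      moreover have "?c x \<otimes>\<^bsub>?K\<^esub> inv\<^bsub>?K\<^esub> ?c y \<in> S"
        using xy by (intro S.m_closed S.m_inv_closed) auto
      ultimately show "x - y \<in> ?T"
        using xy by (auto intro: add_closed_diff add_closed_frags)
    qed
    moreover have "rel n r \<subseteq> ?T"
    proof
      fix x assume x: "x \<in> rel n r"
      then have xf: "x \<in> frags (V n)" using rel_frags[OF n r] by blast
      have "?c x = ?c 0" using x by (subst c_eq) simp
      then show "x \<in> ?T" using xf c.hom_one S.one_closed by simp
    qed
    moreover have "C \<subseteq> ?T" "B \<subseteq> ?T" "\<forall>i\<in>{1..n - 2}. A i \<subseteq> ?T"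
      using gen S(2) by (auto simp: generating_def torsion_family_def subset_iff)
    ultimately have "frags (V n) \<subseteq> ?T" using gen unfolding generating_def by blast
    then show "S = carrier ?K" using carK S.subset by auto
  next
    assume fin: "finite (carrier ?K)"
    obtain R e where R: "R \<subseteq> frags (V n)" "separated (rel n r) R"
      "card R = (m + 1) ^ (m - 1) * m ^ e" "e + m + n = (m + 1) * m ^ (n - 1)"
      using separated_exists[of r k] r k by auto
    \<comment> \<open>Both exponents satisfy the same additive equation, so there are as many
      representatives of distinct cosets as elements of \<open>target n\<close>.\<close>
    have "e = (n - 1) * (m\<^sup>2 - 2) + (\<Sum>i\<in>{1..n - 2}. i * block_size n i)"
      using exponent_total[OF n] R(4) by linarith
    then have "card (carrier (target n)) = card R" using R(3) by (simp only: card_target)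
    also have "\<dots> = card (?c ` R)"
    proof (rule card_image[symmetric], rule inj_onI)
      fix x y assume "x \<in> R" "y \<in> R" "?c x = ?c y"
      then show "x = y" using R(1,2) c_eq[of x y] by (auto simp: separated_def)
    qed
    also have "\<dots> \<le> card (carrier ?K)"
      using R(1) carK fin by (intro card_mono) auto
    finally show "card (carrier (target n)) \<le> card (carrier ?K)" .
  qed
  then show ?thesis using critical_group_eq[OF n r] by simp
qed

end

theorem theorem5p2:
  fixes m n :: nat and r :: "nat list"
  assumes "m \<ge> 2" and "n \<ge> 1"
    and "r \<in> verts (kautz_graph n m)"
  shows "critical_group (kautz_graph n m) r \<cong>
    cyclic_power (m + 1) (m - 1) \<times>\<times>
    cyclic_power (m ^ (n - 1)) (m\<^sup>2 - 2) \<times>\<times>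
    sum_group {1..n - 2} (\<lambda>i. cyclic_power (m ^ i) (m ^ (n - 2 - i) * (m - 1)\<^sup>2 * (m + 1)))"
proof -
  interpret kautz m by unfold_locales (rule assms(1))
  have "r \<in> V n" using assms(3) by (simp add: kautz_graph_def)
  from critical_group_iso_target[OF assms(2) this] show ?thesis
    by (simp add: target_def block_size_def)
qed

end
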